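(* Let $n\ge 1$ be an integer and let $A_1,\dots,A_n\in C_p$ for some real $p>0$, such that $\sum_{i=1}^n A_i=0$. Then, for each choice of the sign $\pm$ (the same sign in all terms of the sum): if $0<p\le 2$, $$2^{p/2}n^{p-1}\sum_{i=1}^n\|A_i\|_p^p\le \sum_{i,j=1}^n\|A_i\pm A_j\|_p^p;$$ and if $2\le p<\infty$, $$\sum_{i,j=1}^n\|A_i\pm A_j\|_p^p\le 2^{p/2}n^{p-1}\sum_{i=1}^n\|A_i\|_p^p.$$ In particular, in the case $p=2$, $\sum_{i,j=1}^n\|A_i-A_j\|_2^2=2n\sum_{i=1}^n\|A_i\|_2^2$.
   Context: $\mathcal{H}$ is a separable complex Hilbert space and $B(\mathcal{H})$ is the algebra of all bounded linear operators on $\mathcal{H}$. For $A\in B(\mathcal{H})$, $|A|=(A^*A)^{1/2}$. For a compact operator $A\in B(\mathcal{H})$ and $0<p<\infty$, the Schatten $p$-norm (only a quasi-norm when $0<p<1$) is $\|A\|_p=(\operatorname{tr}|A|^p)^{1/p}$, where $\operatorname{tr}$ is the usual trace. The Schatten $p$-class $C_p$ is the set of compact operators $A\in B(\mathcal{H})$ with $\|A\|_p<\infty$; it is a two-sided ideal of $B(\mathcal{H})$. *)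

theory Defs
  imports
    "HOL-Analysis.Analysis"
    "HOL-Computational_Algebra.Polynomial"
begin

(* The library has only real inner product spaces.  A complex inner product space is a real one
   together with a complex scalar multiplication and a complex inner product (linear in the first
   argument) whose real part is the given real inner product; norm, topology and positive
   definiteness are those of real_inner. *)
class complex_inner = real_inner +
  fixes scaleC :: "complex \<Rightarrow> 'a \<Rightarrow> 'a"  (infixr "*\<^sub>C" 75)
    and cinner :: "'a \<Rightarrow> 'a \<Rightarrow> complex"
  assumes scaleC_add_right: "c *\<^sub>C (x + y) = c *\<^sub>C x + c *\<^sub>C y"
    and scaleC_add_left: "(c + d) *\<^sub>C x = c *\<^sub>C x + d *\<^sub>C x"
    and scaleC_scaleC: "c *\<^sub>C d *\<^sub>C x = (c * d) *\<^sub>C x"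
    and scaleR_eq_scaleC: "r *\<^sub>R x = complex_of_real r *\<^sub>C x"
    and cinner_commute: "cinner x y = cnj (cinner y x)"
    and cinner_add_left: "cinner (x + y) z = cinner x z + cinner y z"
    and cinner_scaleC_left: "cinner (c *\<^sub>C x) y = c * cinner x y"
    and inner_eq_Re_cinner: "inner x y = Re (cinner x y)"

class complex_hilbert_space = complex_inner + complete_space

instantiation complex :: complex_hilbert_space
begin

definition scaleC_complex :: "complex \<Rightarrow> complex \<Rightarrow> complex"
  where "scaleC_complex c x = c * x"

definition cinner_complex :: "complex \<Rightarrow> complex \<Rightarrow> complex"
  where "cinner_complex x y = x * cnj y"

instance
  by standard
    (simp_all add: scaleC_complex_def cinner_complex_def algebra_simps scaleR_conv_of_real
      inner_complex_def)

end

(* B(H): the type of bounded linear functions is over the reals, so complex homogeneity has to be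
   required.  The operator norm is the same over both fields. *)
definition bounded_operators :: "('a::complex_hilbert_space \<Rightarrow>\<^sub>L 'a) set"
  where "bounded_operators = {T. \<forall>c x. blinfun_apply T (c *\<^sub>C x) = c *\<^sub>C blinfun_apply T x}"

definition adj :: "('a::complex_hilbert_space \<Rightarrow>\<^sub>L 'a) \<Rightarrow> ('a \<Rightarrow>\<^sub>L 'a)"
  where "adj T = (THE S. S \<in> bounded_operators \<and>
    (\<forall>x y. cinner (blinfun_apply T x) y = cinner x (blinfun_apply S y)))"

definition compact_operator :: "('a::complex_hilbert_space \<Rightarrow>\<^sub>L 'a) \<Rightarrow> bool"
  where "compact_operator T \<longleftrightarrow>
    T \<in> bounded_operators \<and> compact (closure (blinfun_apply T ` cball 0 1))"

definition poly_operator :: "real poly \<Rightarrow> ('a::complex_hilbert_space \<Rightarrow>\<^sub>L 'a) \<Rightarrow> ('a \<Rightarrow>\<^sub>L 'a)"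
  where "poly_operator q T =
    (\<Sum>k\<le>degree q. coeff q k *\<^sub>R (((o\<^sub>L) T ^^ k) id_blinfun))"

(* T^r for a positive operator T and r > 0, by the continuous functional calculus: the spectrum
   of T lies in [0, norm T], and T^r is the norm limit of q_k(T) for any polynomials q_k that
   converge to t^r uniformly on this interval. *)
definition operator_powr :: "('a::complex_hilbert_space \<Rightarrow>\<^sub>L 'a) \<Rightarrow> real \<Rightarrow> ('a \<Rightarrow>\<^sub>L 'a)"
  where "operator_powr T r = (THE S. \<forall>q.
    uniform_limit {0..norm T} (\<lambda>k::nat. poly (q k)) (\<lambda>t. t powr r) sequentially \<longrightarrow>
    (\<lambda>k. poly_operator (q k) T) \<longlonglongrightarrow> S)"

definition abs_operator :: "('a::complex_hilbert_space \<Rightarrow>\<^sub>L 'a) \<Rightarrow> ('a \<Rightarrow>\<^sub>L 'a)"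
  where "abs_operator A = operator_powr (adj A o\<^sub>L A) (1/2)"

definition orthonormal_basis :: "'a::complex_hilbert_space set \<Rightarrow> bool"
  where "orthonormal_basis B \<longleftrightarrow>
    (\<forall>e\<in>B. norm e = 1) \<and> (\<forall>e\<in>B. \<forall>f\<in>B. e \<noteq> f \<longrightarrow> cinner e f = 0) \<and>
    (\<forall>x. (\<forall>e\<in>B. cinner x e = 0) \<longrightarrow> x = 0)"

(* Trace of a positive operator, with values in [0, \<infinity>].  The sum of the nonnegative reals
   cinner (T e) e does not depend on the orthonormal basis. *)
definition positive_trace :: "('a::complex_hilbert_space \<Rightarrow>\<^sub>L 'a) \<Rightarrow> ennreal"
  where "positive_trace T =
    (\<Sum>\<^sub>\<infinity>e\<in>(SOME B. orthonormal_basis B). ennreal (Re (cinner (blinfun_apply T e) e)))"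

(* x^a for x in [0, \<infinity>] and real a > 0. *)
definition ennreal_powr :: "ennreal \<Rightarrow> real \<Rightarrow> ennreal"
  where "ennreal_powr x a = (if x = \<infinity> then \<infinity> else ennreal (enn2real x powr a))"

definition schatten_norm :: "real \<Rightarrow> ('a::complex_hilbert_space \<Rightarrow>\<^sub>L 'a) \<Rightarrow> ennreal"
  where "schatten_norm p A =
    ennreal_powr (positive_trace (operator_powr (abs_operator A) p)) (1 / p)"

definition schatten_class :: "real \<Rightarrow> ('a::complex_hilbert_space \<Rightarrow>\<^sub>L 'a) set"
  where "schatten_class p = {A. compact_operator A \<and> schatten_norm p A < \<infinity>}"

end

theory Submission
  imports Defs
begin

text \<open>For \<open>q = p / 2\<close>, the \<open>p\<close>-th power of \<open>\<parallel>A\<parallel>\<^sub>p\<close> is \<open>tr |A|\<^sup>2\<^sup>q\<close>, the sum of the \<open>q\<close>-th powers of the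
  eigenvalues of \<open>A\<^sup>* A\<close>.  Since the \<open>A\<^sub>i\<close> sum to zero, the parallelogram law gives the operator identity
  \<open>\<Sum>\<^sub>i\<^sub>j |A\<^sub>i \<plusminus> A\<^sub>j|\<^sup>2 = 2 n \<Sum>\<^sub>i |A\<^sub>i|\<^sup>2\<close>.  Write \<open>Z\<close> for this operator.  For \<open>q \<le> 1\<close>, McCarthy's subadditivity
  bounds \<open>tr Z\<^sup>q\<close> by \<open>\<Sum>\<^sub>i\<^sub>j tr |A\<^sub>i \<plusminus> A\<^sub>j|\<^sup>2\<^sup>q\<close>, and concavity of the trace of \<open>q\<close>-th powers bounds it from below
  by \<open>n\<^sup>q\<^sup>-\<^sup>1 \<Sum>\<^sub>i tr (2 n |A\<^sub>i|\<^sup>2)\<^sup>q\<close>; for \<open>q \<ge> 1\<close> both inequalities are reversed.  At \<open>p = 2\<close> the two resulting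
  bounds coincide.

  Subadditivity needs no operator monotonicity: for \<open>0 \<le> Y \<le> Z\<close> and a unit eigenvector \<open>f\<close> of \<open>Y\<close> with
  eigenvalue \<open>\<mu> > 0\<close> one has \<open>\<langle>Z\<^sup>-\<^sup>1 f, f\<rangle> \<le> \<mu>\<^sup>-\<^sup>1\<close>, and Jensen's inequality for the spectral weights of \<open>f\<close> with
  respect to \<open>Z\<close> turns this into a comparison of \<open>\<langle>Z\<^sup>q\<^sup>-\<^sup>1 f, f\<rangle>\<close> with \<open>\<mu>\<^sup>q\<^sup>-\<^sup>1\<close>.  Multiplying by \<open>\<mu>\<close> and summing over an
  eigenbasis of \<open>Y\<close> compares \<open>tr Y\<^sup>q\<close> with \<open>tr Z\<^sup>q\<^sup>-\<^sup>1 Y\<close>.\<close>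

section \<open>Complex inner products, Riesz representation and adjoints\<close>

\<comment> \<open>Completeness of the vector space makes the bounded operators complete in operator
  norm, where the limits defining powers are taken.\<close>
subclass (in complex_hilbert_space) banach ..

lemma cinner_add_right: "cinner x (y + z) = cinner x y + cinner x z"
  by (metis cinner_add_left cinner_commute complex_cnj_add)

lemma cinner_scaleC_right: "cinner x (c *\<^sub>C y) = cnj c * cinner x y"
  by (metis cinner_scaleC_left cinner_commute complex_cnj_mult)

lemma cinner_scaleR_left: "cinner (r *\<^sub>R x) y = complex_of_real r * cinner x y"
  by (simp add: scaleR_eq_scaleC cinner_scaleC_left)

lemma cinner_scaleR_right: "cinner x (r *\<^sub>R y) = complex_of_real r * cinner x y"
  by (simp add: scaleR_eq_scaleC cinner_scaleC_right)

lemma cinner_minus_left: "cinner (- x) y = - cinner x y"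
  using cinner_scaleR_left[of "-1" x y] by simp

lemma cinner_diff_left: "cinner (x - y) z = cinner x z - cinner y z"
  using cinner_add_left[of x "- y" z] by (simp add: cinner_minus_left)

lemma cinner_zero_left [simp]: "cinner 0 y = 0"
  using cinner_scaleR_left[of 0 0 y] by simp

lemma cinner_self: "cinner x x = complex_of_real ((norm x)\<^sup>2)"
proof -
  have "Im (cinner x x) = - Im (cinner x x)"
    using cinner_commute[of x x] by (metis cnj.sel(2))
  moreover have "Re (cinner x x) = (norm x)\<^sup>2"
    by (simp add: inner_eq_Re_cinner[symmetric] power2_norm_eq_inner)
  ultimately show ?thesis by (simp add: complex_eq_iff)
qed

lemma norm_scaleC: "norm (c *\<^sub>C x) = cmod c * norm x"
proof -
  have "cinner (c *\<^sub>C x) (c *\<^sub>C x) = complex_of_real ((cmod c)\<^sup>2) * cinner x x"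
    by (simp add: cinner_scaleC_left cinner_scaleC_right mult_ac
      complex_norm_square[unfolded of_real_power])
  hence "complex_of_real ((norm (c *\<^sub>C x))\<^sup>2) = complex_of_real ((cmod c * norm x)\<^sup>2)"
    by (simp add: cinner_self power_mult_distrib)
  hence "(norm (c *\<^sub>C x))\<^sup>2 = (cmod c * norm x)\<^sup>2"
    by (metis of_real_eq_iff)
  thus ?thesis by (simp add: power2_eq_iff_nonneg)
qed

text \<open>The real Cauchy-Schwarz inequality suffices once a unimodular factor \<open>c\<close>
  has rotated \<open>cinner x y\<close> onto the nonnegative real axis.\<close>

lemma norm_cinner_le: "cmod (cinner x y) \<le> norm x * norm y"
proof -
  obtain c where c: "cmod c = 1" "c * cinner x y = complex_of_real (cmod (cinner x y))"
  proof (cases "cinner x y = 0")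
    case True then show ?thesis by (intro that[of 1]) auto
  next
    case False
    show ?thesis
    proof (rule that[of "cnj (cinner x y) / complex_of_real (cmod (cinner x y))"])
      show "cmod (cnj (cinner x y) / complex_of_real (cmod (cinner x y))) = 1"
        using False by (simp add: norm_divide)
      show "cnj (cinner x y) / complex_of_real (cmod (cinner x y)) * cinner x y
        = complex_of_real (cmod (cinner x y))"
        using False complex_norm_square[of "cinner x y"]
        by (simp add: field_simps power2_eq_square)
    qed
  qed
  have "cmod (cinner x y) = inner (c *\<^sub>C x) y"
    by (simp add: inner_eq_Re_cinner cinner_scaleC_left c)
  also have "\<dots> \<le> norm (c *\<^sub>C x) * norm y" by (rule norm_cauchy_schwarz)
  finally show ?thesis by (simp add: norm_scaleC c)
qed

lemma bounded_linear_cinner_left: "bounded_linear (\<lambda>x. cinner x y)"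
  by (rule bounded_linear_intro[of _ "norm y"])
     (simp_all add: cinner_add_left cinner_scaleR_left norm_cinner_le scaleR_conv_of_real)

lemma bounded_linear_cinner_right: "bounded_linear (cinner x)"
  by (rule bounded_linear_intro[of _ "norm x"])
     (simp_all add: cinner_add_right cinner_scaleR_right norm_cinner_le scaleR_conv_of_real
       mult.commute[of _ "norm x"])

lemma bounded_linear_scaleC: "bounded_linear (scaleC c)"
  by (rule bounded_linear_intro[of _ "cmod c"])
     (simp_all add: scaleC_add_right scaleR_eq_scaleC scaleC_scaleC norm_scaleC mult.commute)

lemma cinner_sum_left: "cinner (\<Sum>i\<in>I. f i) y = (\<Sum>i\<in>I. cinner (f i) y)"
  using linear_sum[OF bounded_linear.linear[OF bounded_linear_cinner_left]] by blast

lemma cinner_sum_right: "cinner x (\<Sum>i\<in>I. f i) = (\<Sum>i\<in>I. cinner x (f i))"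
  using linear_sum[OF bounded_linear.linear[OF bounded_linear_cinner_right]] by blast

lemma cinner_eqI: "(\<And>z. cinner x z = cinner y z) \<Longrightarrow> x = y"
  by (metis cinner_diff_left cinner_self eq_iff_diff_eq_0 norm_eq_zero of_real_eq_0_iff power_eq_0_iff)

lemma scaleC_one: "1 *\<^sub>C x = x"
  using scaleR_eq_scaleC[of 1 x] by simp

lemma scaleC_zero_left [simp]: "0 *\<^sub>C x = 0"
  using scaleR_eq_scaleC[of 0 x] by simp

lemma scaleC_diff_left: "(c - d) *\<^sub>C x = c *\<^sub>C x - d *\<^sub>C x"
  using scaleC_add_left[of "c - d" d x] by simp

lemma scaleC_sum_right: "c *\<^sub>C (\<Sum>i\<in>I. f i) = (\<Sum>i\<in>I. c *\<^sub>C f i)"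
  using linear_sum[OF bounded_linear.linear[OF bounded_linear_scaleC]] by blast

lemma scaleC_zero_right [simp]: "c *\<^sub>C 0 = 0"
  using linear_0[OF bounded_linear.linear[OF bounded_linear_scaleC]] .

lemma mult_cnj_cmod: "z * cnj z = complex_of_real ((cmod z)\<^sup>2)" "cnj z * z = complex_of_real ((cmod z)\<^sup>2)"
  by (simp_all only: complex_norm_square mult.commute)

text \<open>Through this, real orthogonality to both \<open>y\<close> and
  \<open>\<i> *\<^sub>C y\<close> becomes complex orthogonality to \<open>y\<close>.\<close>

lemma Im_cinner: "Im (cinner x y) = inner x (\<i> *\<^sub>C y)"
  by (simp add: inner_eq_Re_cinner cinner_scaleC_right)

section \<open>Nearest points, orthogonal projection and Riesz representation\<close>

lemma subspace_closure:
  fixes S :: "'a::real_normed_vector set"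
  assumes "subspace S"
  shows "subspace (closure S)"
  unfolding subspace_def
proof (intro conjI ballI allI)
  show "0 \<in> closure S" using subspace_0[OF assms] closure_subset by blast
  fix x y assume "x \<in> closure S" "y \<in> closure S"
  then obtain u v where "\<And>n. u n \<in> S" "u \<longlonglongrightarrow> x" "\<And>n. v n \<in> S" "v \<longlonglongrightarrow> y"
    by (auto simp: closure_sequential)
  thus "x + y \<in> closure S"
    unfolding closure_sequential
    by (intro exI[of _ "\<lambda>n. u n + v n"]) (simp add: subspace_add[OF assms] tendsto_add)
next
  fix c :: real and x assume "x \<in> closure S"
  then obtain u where "\<And>n. u n \<in> S" "u \<longlonglongrightarrow> x" by (auto simp: closure_sequential)
  thus "c *\<^sub>R x \<in> closure S"
    unfolding closure_sequential
    by (intro exI[of _ "\<lambda>n. c *\<^sub>R u n"]) (simp add: subspace_scale[OF assms] tendsto_scaleR)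
qed

text \<open>By the parallelogram law a minimizing sequence is Cauchy: midpoints stay in the convex
  set and cannot have norm below the infimum \<open>d\<close>.\<close>

lemma exists_min_norm:
  fixes S :: "'a::{real_inner,complete_space} set"
  assumes "closed S" "convex S" "S \<noteq> {}"
  obtains z where "z \<in> S" "\<And>y. y \<in> S \<Longrightarrow> norm z \<le> norm y"
proof -
  define d where "d = Inf (norm ` S)"
  have bdd: "bdd_below (norm ` S)" by (rule bdd_belowI[of _ 0]) auto
  have d_le: "d \<le> norm y" if "y \<in> S" for y
    unfolding d_def using that bdd by (intro cInf_lower) auto
  have d0: "0 \<le> d" unfolding d_def using assms(3) by (intro cInf_greatest) auto
  have "\<exists>y\<in>S. norm y < d + 1 / Suc k" for k
  proof -
    have "Inf (norm ` S) < d + 1 / Suc k" unfolding d_def by simp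
    thus ?thesis using cInf_less_iff[of "norm ` S"] bdd assms(3) by auto
  qed
  then obtain y where yS: "\<And>k. y k \<in> S" and y: "\<And>k. norm (y k) < d + 1 / Suc k"
    by metis
  have par: "(norm (u - v))\<^sup>2 \<le> 2 * (norm u)\<^sup>2 + 2 * (norm v)\<^sup>2 - 4 * d\<^sup>2" if "u \<in> S" "v \<in> S" for u v
  proof -
    have "(1/2) *\<^sub>R u + (1/2) *\<^sub>R v \<in> S"
      using convexD[OF assms(2) that, of "1/2" "1/2"] by simp
    hence "d \<le> norm ((1/2) *\<^sub>R (u + v))" by (intro d_le) (simp add: scaleR_add_right)
    hence "2 * d \<le> norm (u + v)" by simp
    hence "(2 * d)\<^sup>2 \<le> (norm (u + v))\<^sup>2" using d0 by (intro power_mono) auto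
    moreover have "(norm (u - v))\<^sup>2 + (norm (u + v))\<^sup>2 = 2 * (norm u)\<^sup>2 + 2 * (norm v)\<^sup>2"
      by (simp add: power2_norm_eq_inner inner_add_left inner_add_right inner_diff_left
        inner_diff_right inner_commute)
    ultimately show ?thesis by (simp add: power_mult_distrib)
  qed
  have bound: "(norm (y k))\<^sup>2 \<le> d\<^sup>2 + (2 * d + 1) / Suc k" for k
  proof -
    have "(norm (y k))\<^sup>2 \<le> (d + 1 / Suc k)\<^sup>2"
      using y[of k] by (intro power_mono) auto
    also have "\<dots> = d\<^sup>2 + 2 * d / Suc k + (1 / Suc k) * (1 / Suc k)"
      by (simp add: power2_eq_square algebra_simps)
    also have "\<dots> \<le> d\<^sup>2 + 2 * d / Suc k + 1 / Suc k * 1"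
      by (intro add_left_mono mult_left_mono) auto
    finally show ?thesis by (simp add: add_divide_distrib)
  qed
  have lim0: "(\<lambda>k. (2 * d + 1) / real (Suc k)) \<longlonglongrightarrow> 0"
    using LIMSEQ_Suc[OF lim_const_over_n[of "2 * d + 1"]] by simp
  have "Cauchy y"
  proof (rule metric_CauchyI)
    fix e :: real assume e: "0 < e"
    \<comment> \<open>By \<open>par\<close> and \<open>bound\<close> the squared distance of two
      terms is at most twice the sum of their errors, so \<open>e\<^sup>2 / 4\<close> for each error
      suffices.\<close>
    have "\<forall>\<^sub>F k in sequentially. (2 * d + 1) / real (Suc k) < e\<^sup>2 / 4"
      using lim0 e by (intro order_tendstoD) auto
    then obtain N where N: "\<And>k. k \<ge> N \<Longrightarrow> (2 * d + 1) / real (Suc k) < e\<^sup>2 / 4"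
      by (auto simp: eventually_sequentially)
    have "dist (y m) (y k) < e" if "m \<ge> N" "k \<ge> N" for m k
    proof -
      have "(norm (y m - y k))\<^sup>2 < e\<^sup>2"
        using par[OF yS yS, of m k] bound[of m] bound[of k] N[OF that(1)] N[OF that(2)] by linarith
      thus ?thesis using e by (simp add: dist_norm power_less_imp_less_base)
    qed
    thus "\<exists>M. \<forall>m\<ge>M. \<forall>n\<ge>M. dist (y m) (y n) < e" by blast
  qed
  then obtain z where z: "y \<longlonglongrightarrow> z" using Cauchy_convergent convergent_def by blast
  have "z \<in> S" using assms(1) z yS closed_sequentially by blast
  moreover have "norm z \<le> d"
  proof (rule LIMSEQ_le[OF tendsto_norm[OF z]])
    show "(\<lambda>k. d + 1 / Suc k) \<longlonglongrightarrow> d"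
      using tendsto_add[OF tendsto_const LIMSEQ_Suc[OF lim_const_over_n[of 1]], of d] by simp
    show "\<exists>N. \<forall>n\<ge>N. norm (y n) \<le> d + 1 / real (Suc n)" using y less_imp_le by blast
  qed
  ultimately show ?thesis using d_le that by force
qed

text \<open>The residual is the vector of least norm in \<open>x - M\<close>; subtracting a nonzero
  component along some \<open>m\<close> would shorten it.\<close>

lemma exists_orthogonal_projection:
  fixes M :: "'a::{real_inner,complete_space} set"
  assumes "closed M" "subspace M"
  obtains y where "y \<in> M" "\<And>m. m \<in> M \<Longrightarrow> inner (x - y) m = 0"
proof -
  let ?S = "(\<lambda>m. x - m) ` M"
  have "closed ?S"
  proof -
    have "?S = (\<lambda>v. x + v) ` (uminus ` M)" by (auto simp: image_image)
    moreover have "closed (uminus ` M)" using assms(1) by (rule closed_negations)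
    ultimately show ?thesis using closed_translation by metis
  qed
  moreover have "convex ?S"
  proof -
    have "?S = (\<lambda>v. x + v) ` (uminus ` M)" by (auto simp: image_image)
    thus ?thesis
      by (metis assms(2) convex_negations convex_translation subspace_imp_convex)
  qed
  moreover have "?S \<noteq> {}" using subspace_0[OF assms(2)] by auto
  ultimately obtain z where z: "z \<in> ?S" "\<And>v. v \<in> ?S \<Longrightarrow> norm z \<le> norm v"
    using exists_min_norm by blast
  then obtain y where y: "y \<in> M" "z = x - y" by auto
  have "inner z m = 0" if m: "m \<in> M" for m
  proof (cases "m = 0")
    case False
    \<comment> \<open>The value of \<open>t\<close> that minimizes the norm of
      \<open>z - t *\<^sub>R m\<close>.\<close>
    define t where "t = inner z m / (norm m)\<^sup>2"
    have "y + t *\<^sub>R m \<in> M" using y m assms(2) by (simp add: subspace_add subspace_scale)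
    hence "norm z \<le> norm (z - t *\<^sub>R m)" using z(2)[of "x - (y + t *\<^sub>R m)"] y by (auto simp: algebra_simps)
    hence "(norm z)\<^sup>2 \<le> (norm (z - t *\<^sub>R m))\<^sup>2" by (intro power_mono) auto
    also have "\<dots> = (norm z)\<^sup>2 - 2 * t * inner z m + t * t * (norm m)\<^sup>2"
      by (simp add: power2_norm_eq_inner inner_diff_left inner_diff_right inner_commute algebra_simps)
    also have "\<dots> = (norm z)\<^sup>2 - (inner z m)\<^sup>2 / (norm m)\<^sup>2"
      using False by (simp add: t_def field_simps power2_eq_square)
    finally have "(inner z m)\<^sup>2 / (norm m)\<^sup>2 \<le> 0" by simp
    thus ?thesis using False by (simp add: divide_le_0_iff)
  qed auto
  thus ?thesis using that y by blast
qed

text \<open>A vector \<open>u\<close> orthogonal to the kernel represents \<open>f\<close> up to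
  scaling, because \<open>x - (f x / f u) *\<^sub>R u\<close> always lies in the kernel.\<close>

lemma riesz_representation:
  fixes f :: "'a::{real_inner,complete_space} \<Rightarrow> real"
  assumes "bounded_linear f"
  obtains z where "\<And>x. f x = inner x z"
proof (cases "\<forall>x. f x = 0")
  case True
  then show ?thesis using that[of 0] by simp
next
  case False
  interpret f: bounded_linear f by fact
  from False obtain x0 where x0: "f x0 \<noteq> 0" by blast
  define M where "M = {x. f x = 0}"
  have "closed M" unfolding M_def
    by (intro closed_Collect_eq continuous_intros f.continuous_on)
  moreover have "subspace M" unfolding M_def by (auto simp: subspace_def f.add f.scaleR f.zero)
  ultimately obtain y where y: "y \<in> M" "\<And>m. m \<in> M \<Longrightarrow> inner (x0 - y) m = 0"
    using exists_orthogonal_projection by blast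
  define u where "u = x0 - y"
  have fu: "f u \<noteq> 0" using x0 y(1) by (simp add: u_def f.diff M_def)
  hence u0: "u \<noteq> 0" using f.zero by auto
  have "f x = inner x ((f u / (norm u)\<^sup>2) *\<^sub>R u)" for x
  proof -
    have "x - (f x / f u) *\<^sub>R u \<in> M" using fu by (simp add: M_def f.diff f.scaleR)
    hence "inner u (x - (f x / f u) *\<^sub>R u) = 0" using y(2) by (simp add: u_def)
    hence "inner x u = (f x / f u) * (norm u)\<^sup>2"
      by (simp add: inner_diff_right power2_norm_eq_inner inner_commute)
    thus ?thesis using fu u0 by simp
  qed
  thus ?thesis using that by blast
qed

section \<open>Adjoints\<close>

lemma bounded_operators_scaleC:
  "T \<in> bounded_operators \<Longrightarrow> blinfun_apply T (c *\<^sub>C x) = c *\<^sub>C blinfun_apply T x"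
  by (simp add: bounded_operators_def)

text \<open>\<open>adj\<close> is a definite description: a bounded complex-linear operator with the
  defining property is constructed, and nondegeneracy of \<open>cinner\<close> makes it
  unique.\<close>

lemma adj:
  assumes T: "T \<in> bounded_operators"
  shows adj_bounded_operators: "adj T \<in> bounded_operators"
    and cinner_adj_right: "cinner x (blinfun_apply (adj T) y) = cinner (blinfun_apply T x) y"
proof -
  \<comment> \<open>The Riesz representation is real and yields equality of real parts; replacing
    \<open>x\<close> by \<open>\<i> *\<^sub>C x\<close> and using complex homogeneity of
    \<open>T\<close> gives the imaginary parts.\<close>
  have "\<exists>z. \<forall>x. cinner (blinfun_apply T x) y = cinner x z" for y
  proof -
    have "bounded_linear (\<lambda>x. inner (blinfun_apply T x) y)"
      by (intro bounded_linear_compose[OF bounded_linear_inner_left] blinfun.bounded_linear_right)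
    then obtain z where z: "\<And>x. inner (blinfun_apply T x) y = inner x z"
      using riesz_representation by blast
    have "cinner (blinfun_apply T x) y = cinner x z" for x
    proof (rule complex_eqI)
      show "Re (cinner (blinfun_apply T x) y) = Re (cinner x z)"
        using z by (simp add: inner_eq_Re_cinner)
      have "Im (cinner v w) = - Re (cinner (\<i> *\<^sub>C v) w)" for v w :: 'a
        by (simp add: cinner_scaleC_left)
      thus "Im (cinner (blinfun_apply T x) y) = Im (cinner x z)"
        using z[of "\<i> *\<^sub>C x"] T by (simp add: inner_eq_Re_cinner bounded_operators_scaleC)
    qed
    thus ?thesis by blast
  qed
  then obtain S where S: "\<And>x y. cinner (blinfun_apply T x) y = cinner x (S y)" by metis
  have eqI: "u = v" if "\<And>x. cinner x u = cinner x v" for u v :: 'a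
    using that by (metis cinner_commute cinner_eqI)
  have add: "S (u + v) = S u + S v" for u v
    by (rule eqI) (simp add: S[symmetric] cinner_add_right)
  have scC: "S (c *\<^sub>C u) = c *\<^sub>C S u" for c u
    by (rule eqI) (simp add: S[symmetric] cinner_scaleC_right)
  have "bounded_linear S"
  proof (rule bounded_linear_intro[of _ "norm T"])
    show "S (r *\<^sub>R u) = r *\<^sub>R S u" for r u by (simp add: scaleR_eq_scaleC scC)
    show "norm (S u) \<le> norm u * norm T" for u
    proof (cases "S u = 0")
      case False
      have "(norm (S u))\<^sup>2 = cmod (cinner (S u) (S u))"
        by (simp add: cinner_self norm_power)
      also have "\<dots> = cmod (cinner (blinfun_apply T (S u)) u)" by (simp add: S)
      also have "\<dots> \<le> norm (blinfun_apply T (S u)) * norm u" by (rule norm_cinner_le)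
      also have "\<dots> \<le> norm T * norm (S u) * norm u"
        by (intro mult_right_mono norm_blinfun) auto
      finally show ?thesis using False by (simp add: power2_eq_square mult_ac)
    qed auto
  qed (rule add)
  hence bS: "blinfun_apply (Blinfun S) = S" by (rule bounded_linear_Blinfun_apply)
  have ex: "Blinfun S \<in> bounded_operators \<and>
    (\<forall>x y. cinner (blinfun_apply T x) y = cinner x (blinfun_apply (Blinfun S) y))"
    by (simp add: bounded_operators_def bS scC S)
  have "adj T \<in> bounded_operators \<and>
    (\<forall>x y. cinner (blinfun_apply T x) y = cinner x (blinfun_apply (adj T) y))"
    unfolding adj_def
  proof (rule theI[of _ "Blinfun S"])
    fix R assume R: "R \<in> bounded_operators \<and>
      (\<forall>x y. cinner (blinfun_apply T x) y = cinner x (blinfun_apply R y))"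
    show "R = Blinfun S"
      by (rule blinfun_eqI, rule eqI) (metis R S bS)
  qed (rule ex)
  thus "adj T \<in> bounded_operators"
    "cinner x (blinfun_apply (adj T) y) = cinner (blinfun_apply T x) y" by auto
qed

section \<open>Parseval's identity and diagonal operators\<close>

text \<open>The conditions of \<open>orthonormal_basis\<close> without totality, as satisfied by
  finite subfamilies and by the sets in the Zorn argument.\<close>

definition orthonormal :: "'a::complex_hilbert_space set \<Rightarrow> bool"
  where "orthonormal B \<longleftrightarrow> (\<forall>e\<in>B. norm e = 1) \<and> (\<forall>e\<in>B. \<forall>f\<in>B. e \<noteq> f \<longrightarrow> cinner e f = 0)"

lemma orthonormal_subset: "orthonormal B \<Longrightarrow> F \<subseteq> B \<Longrightarrow> orthonormal F"
  by (auto simp: orthonormal_def)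

lemma orthonormal_basis_orthonormal: "orthonormal_basis B \<Longrightarrow> orthonormal B"
  by (auto simp: orthonormal_basis_def orthonormal_def)

lemma orthonormal_cinner:
  "orthonormal B \<Longrightarrow> e \<in> B \<Longrightarrow> f \<in> B \<Longrightarrow> cinner e f = (if e = f then 1 else 0)"
  by (simp add: orthonormal_def cinner_self)

lemma cinner_orthonormal_sum:
  assumes "finite F" "orthonormal F" "e \<in> F"
  shows "cinner (\<Sum>f\<in>F. c f *\<^sub>C f) e = c e"
proof -
  have "cinner (\<Sum>f\<in>F. c f *\<^sub>C f) e = (\<Sum>f\<in>F. if f = e then c f else 0)"
    unfolding cinner_sum_left
    by (intro sum.cong refl) (simp add: cinner_scaleC_left orthonormal_cinner[OF assms(2) _ assms(3)])
  thus ?thesis using assms by simp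
qed

lemma norm_orthonormal_sum:
  assumes "finite F" "orthonormal F"
  shows "(norm (\<Sum>f\<in>F. c f *\<^sub>C f))\<^sup>2 = (\<Sum>f\<in>F. (cmod (c f))\<^sup>2)"
proof -
  define v where "v = (\<Sum>f\<in>F. c f *\<^sub>C f)"
  have "cinner v v = (\<Sum>f\<in>F. cinner v (c f *\<^sub>C f))"
    by (subst (2) v_def) (simp only: cinner_sum_right)
  also have "\<dots> = (\<Sum>f\<in>F. complex_of_real ((cmod (c f))\<^sup>2))"
    unfolding v_def
    by (intro sum.cong refl)
       (simp only: cinner_scaleC_right cinner_orthonormal_sum[OF assms] mult_cnj_cmod)
  finally have "complex_of_real ((norm v)\<^sup>2) = complex_of_real (\<Sum>f\<in>F. (cmod (c f))\<^sup>2)"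
    by (simp only: cinner_self of_real_sum)
  thus ?thesis by (simp only: of_real_eq_iff v_def)
qed

text \<open>Bessel's inequality: the squared norm of the projection is its inner product with
  \<open>x\<close>, to which Cauchy-Schwarz applies.\<close>

lemma norm_orthonormal_projection_le:
  assumes "finite F" "orthonormal F"
  shows "norm (\<Sum>e\<in>F. cinner x e *\<^sub>C e) \<le> norm x"
proof -
  let ?P = "\<Sum>e\<in>F. cinner x e *\<^sub>C e"
  have "complex_of_real ((norm ?P)\<^sup>2) = (\<Sum>e\<in>F. complex_of_real ((cmod (cinner x e))\<^sup>2))"
    by (simp only: norm_orthonormal_sum[OF assms] of_real_sum)
  also have "\<dots> = (\<Sum>e\<in>F. cinner x (cinner x e *\<^sub>C e))"
    by (intro sum.cong refl) (simp only: cinner_scaleC_right mult_cnj_cmod)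
  also have "\<dots> = cinner x ?P" by (simp only: cinner_sum_right)
  finally have "(norm ?P)\<^sup>2 = cmod (cinner x ?P)" by (metis norm_of_real abs_of_nonneg zero_le_power2)
  also have "\<dots> \<le> norm x * norm ?P" by (rule norm_cinner_le)
  finally show ?thesis by (cases "?P = 0") (auto simp: power2_eq_square)
qed

text \<open>Totality makes the span of the basis dense. Finite projections are contractions and
  eventually fix each vector of the span, so their error at \<open>x\<close> is controlled by an
  approximation of \<open>x\<close> from the span.\<close>

lemma orthonormal_basis_has_sum:
  assumes B: "orthonormal_basis B"
  shows "((\<lambda>e. cinner x e *\<^sub>C e) has_sum x) B"
proof -
  let ?P = "\<lambda>F v. \<Sum>e\<in>F. cinner v e *\<^sub>C e"
  \<comment> \<open>The real span of all complex multiples is the complex span, so real subspace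
    arguments apply.\<close>
  define M where "M = closure (span {c *\<^sub>C e | c e. e \<in> B})"
  have on: "orthonormal F" if "F \<subseteq> B" for F
    using orthonormal_subset[OF orthonormal_basis_orthonormal[OF B] that] .
  have "closed M" "subspace M"
    by (simp_all only: M_def closed_closure subspace_closure[OF subspace_span])
  then obtain y where y: "y \<in> M" "\<And>m. m \<in> M \<Longrightarrow> inner (x - y) m = 0"
    using exists_orthogonal_projection[of M x] by metis
  have "cinner (x - y) e = 0" if "e \<in> B" for e
  proof -
    have "c *\<^sub>C e \<in> M" for c
      unfolding M_def using that by (intro subsetD[OF closure_subset] span_base) blast
    from y(2)[OF this[of 1]] y(2)[OF this[of \<i>]] show ?thesis
      by (intro complex_eqI) (simp_all add: Im_cinner inner_eq_Re_cinner scaleC_one)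
  qed
  hence "x - y = 0" using B unfolding orthonormal_basis_def by blast
  hence x: "x \<in> M" using y by simp
  have fixed: "\<exists>F. finite F \<and> F \<subseteq> B \<and> (\<forall>G. finite G \<longrightarrow> F \<subseteq> G \<longrightarrow> G \<subseteq> B \<longrightarrow> ?P G m = m)"
    if "m \<in> span {c *\<^sub>C e | c e. e \<in> B}" for m
    using that
  proof (induction rule: span_induct_alt)
    case base
    show ?case by (intro exI[of _ "{}"]) simp
  next
    case (step r v m)
    then obtain c e where v: "v = c *\<^sub>C e" "e \<in> B" by blast
    from step obtain F where F: "finite F" "F \<subseteq> B"
      "\<And>G. finite G \<Longrightarrow> F \<subseteq> G \<Longrightarrow> G \<subseteq> B \<Longrightarrow> ?P G m = m" by blast
    have "?P G (r *\<^sub>R v + m) = r *\<^sub>R v + m" if G: "finite G" "insert e F \<subseteq> G" "G \<subseteq> B" for G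
    proof -
      have "?P G v = (\<Sum>f\<in>G. if f = e then c *\<^sub>C e else 0)"
        using v G orthonormal_cinner[OF on[OF G(3)]]
        by (intro sum.cong refl) (auto simp: cinner_scaleC_left)
      hence "?P G v = v" using G v by simp
      moreover have "?P G (r *\<^sub>R v + m) = r *\<^sub>R ?P G v + ?P G m"
        by (simp add: cinner_add_left cinner_scaleR_left scaleC_add_left sum.distrib
          scaleR_eq_scaleC[of r "?P G v"] scaleC_sum_right scaleC_scaleC)
      ultimately show ?thesis using F(3)[of G] G by simp
    qed
    thus ?case using F v by (intro exI[of _ "insert e F"]) auto
  qed
  show ?thesis
    unfolding has_sum_def tendsto_iff eventually_finite_subsets_at_top
  proof (intro allI impI)
    fix d :: real assume d: "d > 0"
    obtain m where m: "m \<in> span {c *\<^sub>C e | c e. e \<in> B}" "dist m x < d / 2"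
      using x d unfolding M_def closure_approachable by (meson half_gt_zero)
    obtain F where F: "finite F" "F \<subseteq> B"
      "\<And>G. finite G \<Longrightarrow> F \<subseteq> G \<Longrightarrow> G \<subseteq> B \<Longrightarrow> ?P G m = m" using fixed[OF m(1)] by blast
    have "dist (?P G x) x < d" if G: "finite G" "F \<subseteq> G" "G \<subseteq> B" for G
    proof -
      have "?P G x - m = ?P G (x - m)"
        using F(3)[OF G] by (simp add: cinner_diff_left scaleC_diff_left sum_subtractf)
      hence "norm (?P G x - m) \<le> norm (x - m)"
        using norm_orthonormal_projection_le[OF G(1) on[OF G(3)]] by metis
      hence "dist (?P G x) m < d / 2" using m(2) by (simp add: dist_norm norm_minus_commute)
      thus ?thesis using m(2) dist_triangle[of "?P G x" x m] by linarith
    qed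
    thus "\<exists>X. finite X \<and> X \<subseteq> B \<and> (\<forall>Y. finite Y \<and> X \<subseteq> Y \<and> Y \<subseteq> B \<longrightarrow> dist (?P Y x) x < d)"
      using F by blast
  qed
qed

lemma cmod_cinner_commute: "cmod (cinner x y) = cmod (cinner y x)"
  by (metis cinner_commute complex_mod_cnj)

lemma parseval:
  assumes "orthonormal_basis B"
  shows "((\<lambda>e. (cmod (cinner x e))\<^sup>2) has_sum (norm x)\<^sup>2) B"
proof -
  have "((\<lambda>e. cinner (cinner x e *\<^sub>C e) x) has_sum cinner x x) B"
    by (rule has_sum_bounded_linear[OF bounded_linear_cinner_left orthonormal_basis_has_sum[OF assms]])
  hence "((\<lambda>e. Re (cinner (cinner x e *\<^sub>C e) x)) has_sum Re (cinner x x)) B" by (rule has_sum_Re)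
  moreover have "Re (cinner (cinner x e *\<^sub>C e) x) = (cmod (cinner x e))\<^sup>2" for e
    using cinner_commute[of e x] complex_norm_square[of "cinner x e", symmetric]
    by (simp add: cinner_scaleC_left)
  ultimately show ?thesis by (simp add: cinner_self)
qed

text \<open>Eigenvalues are indexed by the basis vectors, so that a sum over \<open>B\<close> counts
  them with multiplicity.\<close>

definition diagonalizes ::
    "'a::complex_hilbert_space set \<Rightarrow> ('a \<Rightarrow> real) \<Rightarrow> ('a \<Rightarrow>\<^sub>L 'a) \<Rightarrow> bool"
  where "diagonalizes B \<mu> T \<longleftrightarrow> orthonormal_basis B \<and> T \<in> bounded_operators \<and>
    (\<forall>e\<in>B. 0 \<le> \<mu> e \<and> blinfun_apply T e = \<mu> e *\<^sub>R e)"

lemma diagonalizesD: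
  assumes "diagonalizes B \<mu> T"
  shows "orthonormal_basis B" "T \<in> bounded_operators" "\<And>e. e \<in> B \<Longrightarrow> 0 \<le> \<mu> e"
    "\<And>e. e \<in> B \<Longrightarrow> blinfun_apply T e = \<mu> e *\<^sub>R e" "\<And>e. e \<in> B \<Longrightarrow> norm e = 1"
  using assms by (auto simp: diagonalizes_def orthonormal_basis_def)

lemma diagonalizes_le_norm:
  assumes "diagonalizes B \<mu> T" "e \<in> B"
  shows "\<mu> e \<le> norm T"
  using norm_blinfun[of T e] diagonalizesD[OF assms(1)] assms(2) by simp

text \<open>The continuous functional \<open>v \<mapsto> cinner (T v) x\<close> is applied termwise
  to the expansion of \<open>x\<close> in \<open>B\<close>.\<close>

lemma diagonalizes_quadratic_form:
  assumes T: "diagonalizes B \<mu> T"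
  shows "((\<lambda>e. \<mu> e * (cmod (cinner x e))\<^sup>2) has_sum inner (blinfun_apply T x) x) B"
proof -
  have "bounded_linear (\<lambda>v. cinner (blinfun_apply T v) x)"
    by (rule bounded_linear_compose[OF bounded_linear_cinner_left blinfun.bounded_linear_right])
  hence "((\<lambda>e. Re (cinner (blinfun_apply T (cinner x e *\<^sub>C e)) x))
      has_sum Re (cinner (blinfun_apply T x) x)) B"
    by (intro has_sum_Re has_sum_bounded_linear[of "\<lambda>v. cinner (blinfun_apply T v) x"]
      orthonormal_basis_has_sum diagonalizesD[OF T])
  moreover have "Re (cinner (blinfun_apply T (cinner x e *\<^sub>C e)) x) = \<mu> e * (cmod (cinner x e))\<^sup>2"
    if "e \<in> B" for e
  proof -
    have "cinner (blinfun_apply T (cinner x e *\<^sub>C e)) x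
        = complex_of_real (\<mu> e) * (cinner x e * cnj (cinner x e))"
      using that cinner_commute[of e x]
      by (simp add: bounded_operators_scaleC diagonalizesD[OF T] cinner_scaleC_left cinner_scaleR_left mult_ac)
    also have "\<dots> = complex_of_real (\<mu> e * (cmod (cinner x e))\<^sup>2)"
      by (simp add: complex_norm_square[unfolded of_real_power])
    finally show ?thesis by simp
  qed
  ultimately show ?thesis unfolding inner_eq_Re_cinner by (subst has_sum_cong) auto
qed

text \<open>Finite sections of \<open>x\<close> obey the bound by orthonormality and converge to
  \<open>x\<close>. The entries \<open>g\<close> may have either sign, so the estimate applies to
  differences of functions of an operator.\<close>

lemma norm_diagonal_operator_le:
  assumes B: "orthonormal_basis B" and S: "S \<in> bounded_operators"
    and eig: "\<And>e. e \<in> B \<Longrightarrow> blinfun_apply S e = g e *\<^sub>R e" and M: "\<And>e. e \<in> B \<Longrightarrow> \<bar>g e\<bar> \<le> M" "0 \<le> M"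
  shows "norm S \<le> M"
proof (rule norm_blinfun_bound[OF M(2)])
  fix x :: 'a
  let ?P = "\<lambda>F. \<Sum>e\<in>F. cinner x e *\<^sub>C e"
  have le: "norm (blinfun_apply S (?P F)) \<le> M * norm x" if F: "finite F" "F \<subseteq> B" for F
  proof -
    have on: "orthonormal F"
      by (rule orthonormal_subset[OF orthonormal_basis_orthonormal[OF B] F(2)])
    have "blinfun_apply S (?P F) = (\<Sum>e\<in>F. (cinner x e * complex_of_real (g e)) *\<^sub>C e)"
      using F by (auto simp: blinfun.sum_right bounded_operators_scaleC[OF S] eig scaleR_eq_scaleC
        scaleC_scaleC intro!: sum.cong)
    hence "(norm (blinfun_apply S (?P F)))\<^sup>2 = (\<Sum>e\<in>F. (cmod (cinner x e) * \<bar>g e\<bar>)\<^sup>2)"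
      by (simp add: norm_orthonormal_sum[OF F(1) on] norm_mult)
    also have "\<dots> \<le> (\<Sum>e\<in>F. (cmod (cinner x e) * M)\<^sup>2)"
      using F M by (intro sum_mono power_mono mult_left_mono) auto
    also have "\<dots> = M\<^sup>2 * (norm (?P F))\<^sup>2"
      unfolding norm_orthonormal_sum[OF F(1) on] sum_distrib_left
      by (simp add: power_mult_distrib mult.commute)
    also have "\<dots> \<le> (M * norm x)\<^sup>2"
      unfolding power_mult_distrib
      by (intro mult_left_mono power_mono norm_orthonormal_projection_le[OF F(1) on]) auto
    finally show ?thesis by (rule power2_le_imp_le) (simp add: M(2))
  qed
  have "(sum (\<lambda>e. cinner x e *\<^sub>C e) \<longlongrightarrow> x) (finite_subsets_at_top B)"
    using orthonormal_basis_has_sum[OF B] by (simp add: has_sum_def)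
  hence "((\<lambda>F. norm (blinfun_apply S (?P F))) \<longlongrightarrow> norm (blinfun_apply S x)) (finite_subsets_at_top B)"
    by (intro tendsto_norm bounded_linear.tendsto[OF blinfun.bounded_linear_right])
  thus "norm (blinfun_apply S x) \<le> M * norm x"
    by (rule tendsto_upperbound) (auto simp: eventually_finite_subsets_at_top le intro!: exI[of _ "{}"])
qed

section \<open>Functional calculus and trace of diagonal operators\<close>

lemma ennreal_summable_on:
  fixes f :: "'b \<Rightarrow> ennreal"
  shows "f summable_on A"
  by (rule nonneg_summable_on_complete) simp

lemma sum_le_infsum_ennreal:
  fixes f :: "'b \<Rightarrow> ennreal"
  shows "finite F \<Longrightarrow> F \<subseteq> A \<Longrightarrow> sum f F \<le> infsum f A"
  by (simp add: nonneg_infsum_complete SUP_upper)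

lemma infsum_ennreal_eq:
  fixes f :: "'b \<Rightarrow> real"
  assumes "(f has_sum s) A" "\<And>x. x \<in> A \<Longrightarrow> 0 \<le> f x"
  shows "(\<Sum>\<^sub>\<infinity>x\<in>A. ennreal (f x)) = ennreal s"
proof -
  have "infsum (ennreal \<circ> f) A = ennreal (infsum f A)"
    using assms by (intro infsum_comm_additive_general)
      (auto simp: comp_def subset_iff sum_ennreal has_sum_imp_summable)
  thus ?thesis using assms(1) by (simp add: comp_def infsumI)
qed

lemma infsum_sum_ennreal:
  fixes f :: "'b \<Rightarrow> 'c \<Rightarrow> ennreal"
  assumes "finite F"
  shows "(\<Sum>x\<in>F. \<Sum>\<^sub>\<infinity>y\<in>A. f x y) = (\<Sum>\<^sub>\<infinity>y\<in>A. \<Sum>x\<in>F. f x y)"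
  using assms by induction (simp_all add: infsum_add ennreal_summable_on)

text \<open>Tonelli: a finite partial sum of the outer sum can be moved inside, which gives one
  inequality; the other follows by exchanging the roles.\<close>

lemma infsum_swap_ennreal:
  fixes f :: "'b \<Rightarrow> 'c \<Rightarrow> ennreal"
  shows "(\<Sum>\<^sub>\<infinity>x\<in>A. \<Sum>\<^sub>\<infinity>y\<in>B. f x y) = (\<Sum>\<^sub>\<infinity>y\<in>B. \<Sum>\<^sub>\<infinity>x\<in>A. f x y)"
proof -
  have le: "(\<Sum>\<^sub>\<infinity>x\<in>A. \<Sum>\<^sub>\<infinity>y\<in>B. f x y) \<le> (\<Sum>\<^sub>\<infinity>y\<in>B. \<Sum>\<^sub>\<infinity>x\<in>A. f x y)"
    for A :: "'d set" and B :: "'e set" and f :: "'d \<Rightarrow> 'e \<Rightarrow> ennreal"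
  proof (rule infsum_le_finite_sums)
    fix F assume "finite F" "F \<subseteq> A"
    thus "(\<Sum>x\<in>F. \<Sum>\<^sub>\<infinity>y\<in>B. f x y) \<le> (\<Sum>\<^sub>\<infinity>y\<in>B. \<Sum>\<^sub>\<infinity>x\<in>A. f x y)"
      unfolding infsum_sum_ennreal[OF \<open>finite F\<close>]
      by (intro infsum_mono ennreal_summable_on sum_le_infsum_ennreal)
  qed (rule ennreal_summable_on)
  show ?thesis by (intro antisym le)
qed

lemma infsum_cmult_ennreal:
  fixes f :: "'b \<Rightarrow> ennreal"
  shows "(\<Sum>\<^sub>\<infinity>x\<in>A. c * f x) = c * (\<Sum>\<^sub>\<infinity>x\<in>A. f x)"
  by (simp add: nonneg_infsum_complete sum_distrib_left[symmetric] SUP_mult_left_ennreal)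

section \<open>Algebraic and limit closure of the complex-linear operators\<close>

lemma bounded_operatorsI:
  "(\<And>c x. blinfun_apply T (c *\<^sub>C x) = c *\<^sub>C blinfun_apply T x) \<Longrightarrow> T \<in> bounded_operators"
  by (simp add: bounded_operators_def)

lemma bounded_operators_add:
  "S \<in> bounded_operators \<Longrightarrow> T \<in> bounded_operators \<Longrightarrow> S + T \<in> bounded_operators"
  by (simp add: bounded_operators_def blinfun.add_left scaleC_add_right)

lemma bounded_operators_zero: "0 \<in> bounded_operators"
  by (simp add: bounded_operators_def)

lemma bounded_operators_scaleR:
  "T \<in> bounded_operators \<Longrightarrow> r *\<^sub>R T \<in> bounded_operators"
  by (simp add: bounded_operators_def blinfun.scaleR_left scaleR_eq_scaleC scaleC_scaleC mult.commute)

lemma bounded_operators_diff: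
  "S \<in> bounded_operators \<Longrightarrow> T \<in> bounded_operators \<Longrightarrow> S - T \<in> bounded_operators"
  using bounded_operators_add[OF _ bounded_operators_scaleR[of T "-1"], of S] by simp

lemma bounded_operators_sum:
  "(\<And>i. i \<in> I \<Longrightarrow> T i \<in> bounded_operators) \<Longrightarrow> (\<Sum>i\<in>I. T i) \<in> bounded_operators"
  by (induction I rule: infinite_finite_induct)
     (simp_all add: bounded_operators_zero bounded_operators_add)

lemma bounded_operators_compose:
  "S \<in> bounded_operators \<Longrightarrow> T \<in> bounded_operators \<Longrightarrow> S o\<^sub>L T \<in> bounded_operators"
  by (simp add: bounded_operators_def)

lemma bounded_operators_power:
  "T \<in> bounded_operators \<Longrightarrow> ((o\<^sub>L) T ^^ k) id_blinfun \<in> bounded_operators"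
  by (induction k) (simp_all add: bounded_operators_compose, simp add: bounded_operators_def)

lemma bounded_operators_poly_operator:
  "T \<in> bounded_operators \<Longrightarrow> poly_operator q T \<in> bounded_operators"
  unfolding poly_operator_def
  by (intro bounded_operators_sum bounded_operators_scaleR bounded_operators_power)

lemma bounded_operators_LIMSEQ:
  assumes "X \<longlonglongrightarrow> S" "\<And>k. X k \<in> bounded_operators"
  shows "S \<in> bounded_operators"
proof (rule bounded_operatorsI)
  fix c x
  have lim: "(\<lambda>k. blinfun_apply (X k) v) \<longlonglongrightarrow> blinfun_apply S v" for v
    by (rule bounded_linear.tendsto[OF blinfun.bounded_linear_left assms(1)])
  have "(\<lambda>k. c *\<^sub>C blinfun_apply (X k) x) \<longlonglongrightarrow> c *\<^sub>C blinfun_apply S x"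
    by (rule bounded_linear.tendsto[OF bounded_linear_scaleC lim])
  hence "(\<lambda>k. blinfun_apply (X k) (c *\<^sub>C x)) \<longlonglongrightarrow> c *\<^sub>C blinfun_apply S x"
    by (simp add: bounded_operators_scaleC assms(2))
  with lim show "blinfun_apply S (c *\<^sub>C x) = c *\<^sub>C blinfun_apply S x"
    by (rule LIMSEQ_unique)
qed

section \<open>Powers of an operator in its eigenbasis\<close>

lemma poly_operator_eigenvector:
  assumes "blinfun_apply T e = m *\<^sub>R e"
  shows "blinfun_apply (poly_operator q T) e = poly q m *\<^sub>R e"
proof -
  have "blinfun_apply (((o\<^sub>L) T ^^ k) id_blinfun) e = (m ^ k) *\<^sub>R e" for k
    by (induction k) (simp_all add: assms blinfun.scaleR_right mult.commute)
  thus ?thesis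
    by (simp add: poly_operator_def blinfun.sum_left blinfun.scaleR_left poly_altdef
      scaleR_sum_left)
qed

text \<open>Stone-Weierstrass. An approximating sequence must exist for the limit condition in
  \<open>operator_powr\<close> to determine an operator.\<close>

lemma uniform_polynomial_approximation_powr:
  fixes r M :: real
  assumes "0 < r"
  obtains q :: "nat \<Rightarrow> real poly"
  where "uniform_limit {0..M} (\<lambda>k. poly (q k)) (\<lambda>t. t powr r) sequentially"
proof -
  have "\<exists>q. \<forall>t\<in>{0..M}. \<bar>t powr r - poly q t\<bar> < 1 / real (Suc k)" for k
  proof -
    have "continuous_on {0..M} (\<lambda>t. t powr r)"
      using assms by (intro continuous_on_powr' continuous_intros) auto
    then obtain g where g: "real_polynomial_function g"
      "\<And>t. t \<in> {0..M} \<Longrightarrow> \<bar>t powr r - g t\<bar> < 1 / real (Suc k)"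
      using Stone_Weierstrass_real_polynomial_function[of "{0..M}" "\<lambda>t. t powr r" "1 / real (Suc k)"]
      by auto
    then obtain a n where "g = (\<lambda>x. \<Sum>i\<le>n. a i * x ^ i)"
      by (auto simp: real_polynomial_function_iff_sum)
    hence "poly (\<Sum>i\<le>n. monom (a i) i) = g" by (simp add: poly_sum poly_monom fun_eq_iff)
    thus ?thesis using g(2) by metis
  qed
  then obtain q where q: "\<And>k t. t \<in> {0..M} \<Longrightarrow> \<bar>t powr r - poly (q k) t\<bar> < 1 / real (Suc k)"
    by metis
  have "uniform_limit {0..M} (\<lambda>k. poly (q k)) (\<lambda>t. t powr r) sequentially"
  proof (rule uniform_limitI)
    fix e :: real assume "0 < e"
    hence "\<forall>\<^sub>F k in sequentially. 1 / real (Suc k) < e"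
      using LIMSEQ_Suc[OF lim_const_over_n[of "1::real"]] by (intro order_tendstoD) auto
    thus "\<forall>\<^sub>F k in sequentially. \<forall>t\<in>{0..M}. dist (poly (q k) t) (t powr r) < e"
    proof eventually_elim
      case (elim k)
      show ?case
      proof
        fix t assume "t \<in> {0..M}"
        from q[OF this, of k] elim show "dist (poly (q k) t) (t powr r) < e"
          by (simp add: dist_real_def abs_minus_commute)
      qed
    qed
  qed
  thus ?thesis by (rule that)
qed

text \<open>The difference is diagonal with entries
  \<open>poly (q k) (\<mu> e) - \<mu> e powr r\<close>, and the eigenvalues lie in
  \<open>[0, norm T]\<close>, so uniform convergence there bounds the operator norm.\<close>

lemma diagonalizes_poly_operator_LIMSEQ:
  assumes T: "diagonalizes B \<mu> T" and S: "diagonalizes B (\<lambda>e. \<mu> e powr r) S"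
    and q: "uniform_limit {0..norm T} (\<lambda>k. poly (q k)) (\<lambda>t. t powr r) sequentially"
  shows "(\<lambda>k. poly_operator (q k) T) \<longlonglongrightarrow> S"
proof (rule LIMSEQ_I)
  fix d :: real assume "0 < d"
  from uniform_limitD[OF q, of "d / 2"] this
  obtain N where N: "\<forall>k\<ge>N. \<forall>t\<in>{0..norm T}. \<bar>poly (q k) t - t powr r\<bar> < d / 2"
    by (auto simp: eventually_sequentially dist_real_def)
  have "norm (poly_operator (q k) T - S) \<le> d / 2" if "k \<ge> N" for k
  proof (rule norm_diagonal_operator_le)
    show "poly_operator (q k) T - S \<in> bounded_operators"
      by (intro bounded_operators_diff bounded_operators_poly_operator
        diagonalizesD(2)[OF T] diagonalizesD(2)[OF S])
    fix e assume e: "e \<in> B"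
    show "blinfun_apply (poly_operator (q k) T - S) e = (poly (q k) (\<mu> e) - \<mu> e powr r) *\<^sub>R e"
      using diagonalizesD(4)[OF S e] poly_operator_eigenvector[OF diagonalizesD(4)[OF T e]]
      by (simp add: blinfun.diff_left scaleR_diff_left)
    show "\<bar>poly (q k) (\<mu> e) - \<mu> e powr r\<bar> \<le> d / 2"
      using N[rule_format, OF that, of "\<mu> e"] diagonalizesD(3)[OF T e] diagonalizes_le_norm[OF T e] by simp
  qed (use \<open>0 < d\<close> diagonalizesD(1)[OF T] in auto)
  thus "\<exists>N. \<forall>k\<ge>N. norm (poly_operator (q k) T - S) < d"
    using \<open>0 < d\<close> by (intro exI[of _ N]) fastforce
qed

text \<open>The operator with the prescribed eigenvalues arises as a norm limit of polynomials in
  \<open>T\<close>, which are Cauchy by the same diagonal estimate.\<close>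

lemma diagonalizes_powr_exists:
  assumes T: "diagonalizes B \<mu> T" and r: "0 < r"
  obtains S where "diagonalizes B (\<lambda>e. \<mu> e powr r) S"
proof -
  obtain q where q: "uniform_limit {0..norm T} (\<lambda>k. poly (q k)) (\<lambda>t. t powr r) sequentially"
    using uniform_polynomial_approximation_powr[OF r] by blast
  define X where "X = (\<lambda>k. poly_operator (q k) T)"
  have X: "X k \<in> bounded_operators" "\<And>e. e \<in> B \<Longrightarrow> blinfun_apply (X k) e = poly (q k) (\<mu> e) *\<^sub>R e" for k
    using bounded_operators_poly_operator[OF diagonalizesD(2)[OF T]]
      poly_operator_eigenvector[OF diagonalizesD(4)[OF T]] by (simp_all add: X_def)
  have "Cauchy X"
  proof (rule metric_CauchyI)
    fix d :: real assume "0 < d"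
    from uniform_limitD[OF q, of "d / 3"] this
    obtain N where N: "\<forall>k\<ge>N. \<forall>t\<in>{0..norm T}. \<bar>poly (q k) t - t powr r\<bar> < d / 3"
      by (auto simp: eventually_sequentially dist_real_def)
    have "norm (X k - X l) \<le> 2 * (d / 3)" if kl: "k \<ge> N" "l \<ge> N" for k l
    proof (rule norm_diagonal_operator_le)
      fix e assume e: "e \<in> B"
      show "blinfun_apply (X k - X l) e = (poly (q k) (\<mu> e) - poly (q l) (\<mu> e)) *\<^sub>R e"
        using X(2)[OF e] by (simp add: blinfun.diff_left scaleR_diff_left)
      show "\<bar>poly (q k) (\<mu> e) - poly (q l) (\<mu> e)\<bar> \<le> 2 * (d / 3)"
      proof -
        have "\<mu> e \<in> {0..norm T}"
          using diagonalizesD(3)[OF T e] diagonalizes_le_norm[OF T e] by simp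
        with N kl have "\<bar>poly (q k) (\<mu> e) - \<mu> e powr r\<bar> < d / 3"
          "\<bar>poly (q l) (\<mu> e) - \<mu> e powr r\<bar> < d / 3" by blast+
        thus ?thesis by linarith
      qed
    qed (use \<open>0 < d\<close> diagonalizesD(1)[OF T] X in \<open>auto intro: bounded_operators_diff\<close>)
    thus "\<exists>M. \<forall>m\<ge>M. \<forall>n\<ge>M. dist (X m) (X n) < d"
      using \<open>0 < d\<close> by (intro exI[of _ N]) (fastforce simp: dist_norm)
  qed
  then obtain S where S: "X \<longlonglongrightarrow> S" using Cauchy_convergent convergent_def by blast
  have "blinfun_apply S e = (\<mu> e powr r) *\<^sub>R e" if e: "e \<in> B" for e
  proof (rule LIMSEQ_unique)
    show "(\<lambda>k. blinfun_apply (X k) e) \<longlonglongrightarrow> blinfun_apply S e"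
      by (rule bounded_linear.tendsto[OF blinfun.bounded_linear_left S])
    have "(\<lambda>k. poly (q k) (\<mu> e)) \<longlonglongrightarrow> \<mu> e powr r"
      using tendsto_uniform_limitI[OF q, of "\<mu> e"] diagonalizesD(3)[OF T e]
        diagonalizes_le_norm[OF T e] by simp
    thus "(\<lambda>k. blinfun_apply (X k) e) \<longlonglongrightarrow> (\<mu> e powr r) *\<^sub>R e"
      unfolding X(2)[OF e] by (intro tendsto_intros)
  qed
  hence "diagonalizes B (\<lambda>e. \<mu> e powr r) S"
    using bounded_operators_LIMSEQ[OF S X(1)] diagonalizesD(1)[OF T]
    by (simp add: diagonalizes_def)
  thus ?thesis by (rule that)
qed

text \<open>Every approximating sequence leads to the same diagonal operator and at least one such
  sequence exists, so the definite description denotes it.\<close>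

lemma diagonalizes_operator_powr:
  assumes T: "diagonalizes B \<mu> T" and r: "0 < r"
  shows "diagonalizes B (\<lambda>e. \<mu> e powr r) (operator_powr T r)"
proof -
  obtain S where S: "diagonalizes B (\<lambda>e. \<mu> e powr r) S"
    using diagonalizes_powr_exists[OF assms] .
  obtain q where q: "uniform_limit {0..norm T} (\<lambda>k. poly (q k)) (\<lambda>t. t powr r) sequentially"
    using uniform_polynomial_approximation_powr[OF r] by blast
  have "operator_powr T r = S"
    unfolding operator_powr_def
  proof (rule the_equality)
    show "\<forall>q. uniform_limit {0..norm T} (\<lambda>k. poly (q k)) (\<lambda>t. t powr r) sequentially \<longrightarrow>
        (\<lambda>k. poly_operator (q k) T) \<longlonglongrightarrow> S"
      using diagonalizes_poly_operator_LIMSEQ[OF T S] by blast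
    fix R assume "\<forall>q. uniform_limit {0..norm T} (\<lambda>k::nat. poly (q k)) (\<lambda>t. t powr r) sequentially \<longrightarrow>
        (\<lambda>k. poly_operator (q k) T) \<longlonglongrightarrow> R"
    thus "R = S"
      using q diagonalizes_poly_operator_LIMSEQ[OF T S q] LIMSEQ_unique by blast
  qed
  thus ?thesis using S by simp
qed

section \<open>The trace in an eigenbasis\<close>

lemma infsum_infsum_cinner:
  assumes B: "\<And>f. f \<in> B \<Longrightarrow> norm f = 1" and C: "orthonormal_basis C"
    and g: "\<And>f. f \<in> B \<Longrightarrow> 0 \<le> g f"
  shows "(\<Sum>\<^sub>\<infinity>e\<in>C. \<Sum>\<^sub>\<infinity>f\<in>B. ennreal (g f * (cmod (cinner e f))\<^sup>2)) = (\<Sum>\<^sub>\<infinity>f\<in>B. ennreal (g f))"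
proof -
  have "(\<Sum>\<^sub>\<infinity>e\<in>C. \<Sum>\<^sub>\<infinity>f\<in>B. ennreal (g f * (cmod (cinner e f))\<^sup>2))
      = (\<Sum>\<^sub>\<infinity>f\<in>B. \<Sum>\<^sub>\<infinity>e\<in>C. ennreal (g f * (cmod (cinner e f))\<^sup>2))"
    by (rule infsum_swap_ennreal)
  also have "\<dots> = (\<Sum>\<^sub>\<infinity>f\<in>B. ennreal (g f))"
  proof (rule infsum_cong)
    fix f assume f: "f \<in> B"
    \<comment> \<open>Parseval in \<open>C\<close>: the squared coefficients of the unit vector
      \<open>f\<close> sum to 1.\<close>
    have "((\<lambda>e. g f * (cmod (cinner f e))\<^sup>2) has_sum g f * (norm f)\<^sup>2) C"
      by (intro has_sum_cmult_right parseval C)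
    hence "((\<lambda>e. g f * (cmod (cinner e f))\<^sup>2) has_sum g f) C"
      by (subst cmod_cinner_commute) (simp add: B[OF f])
    thus "(\<Sum>\<^sub>\<infinity>e\<in>C. ennreal (g f * (cmod (cinner e f))\<^sup>2)) = ennreal (g f)"
      by (rule infsum_ennreal_eq) (simp add: g[OF f])
  qed
  finally show ?thesis .
qed

text \<open>Expanding each diagonal entry in the eigenbasis transfers the sum from the basis chosen
  by \<open>SOME\<close> to \<open>B\<close>.\<close>

lemma positive_trace_diagonalizes:
  assumes T: "diagonalizes B \<mu> T"
  shows "positive_trace T = (\<Sum>\<^sub>\<infinity>f\<in>B. ennreal (\<mu> f))"
proof -
  define C where "C = (SOME B :: 'a set. orthonormal_basis B)"
  have C: "orthonormal_basis C"
    unfolding C_def using diagonalizesD(1)[OF T] by (rule someI)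
  have "positive_trace T = (\<Sum>\<^sub>\<infinity>e\<in>C. \<Sum>\<^sub>\<infinity>f\<in>B. ennreal (\<mu> f * (cmod (cinner e f))\<^sup>2))"
    unfolding positive_trace_def C_def[symmetric] inner_eq_Re_cinner[symmetric]
    by (intro infsum_cong infsum_ennreal_eq[symmetric] diagonalizes_quadratic_form[OF T])
       (simp add: diagonalizesD(3)[OF T])
  also have "\<dots> = (\<Sum>\<^sub>\<infinity>f\<in>B. ennreal (\<mu> f))"
    by (rule infsum_infsum_cinner[OF diagonalizesD(5)[OF T] C diagonalizesD(3)[OF T]])
  finally show ?thesis .
qed

lemma ennreal_powr_inverse: "0 < p \<Longrightarrow> ennreal_powr (ennreal_powr x (1 / p)) p = x"
  by (cases x) (simp_all add: ennreal_powr_def powr_powr enn2real_eq_0_iff)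

text \<open>The \<open>\<mu> f\<close> are squared singular values of \<open>A\<close>, hence the
  exponent \<open>p / 2\<close>.\<close>

lemma schatten_norm_powr:
  assumes T: "diagonalizes B \<mu> (adj A o\<^sub>L A)" and p: "0 < p"
  shows "ennreal_powr (schatten_norm p A) p = (\<Sum>\<^sub>\<infinity>f\<in>B. ennreal (\<mu> f powr (p / 2)))"
proof -
  have "diagonalizes B (\<lambda>e. (\<mu> e powr (1 / 2)) powr p) (operator_powr (abs_operator A) p)"
    unfolding abs_operator_def by (intro diagonalizes_operator_powr T p) simp
  thus ?thesis
    by (simp add: schatten_norm_def ennreal_powr_inverse[OF p] positive_trace_diagonalizes powr_powr)
qed

section \<open>The spectral theorem for compact positive operators\<close>

lemma compact_operatorI:
  assumes "T \<in> bounded_operators" "compact K" "blinfun_apply T ` cball 0 1 \<subseteq> K"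
  shows "compact_operator T"
proof -
  have "closure (blinfun_apply T ` cball 0 1) \<subseteq> K"
    using assms(2,3) by (simp add: closure_minimal compact_imp_closed)
  hence "compact (K \<inter> closure (blinfun_apply T ` cball 0 1))"
    and "K \<inter> closure (blinfun_apply T ` cball 0 1) = closure (blinfun_apply T ` cball 0 1)"
    using assms(2) by (auto intro: compact_Int_closed)
  thus ?thesis using assms(1) by (simp add: compact_operator_def)
qed

lemma compact_operatorD:
  assumes "compact_operator T"
  shows "T \<in> bounded_operators" "compact (closure (blinfun_apply T ` cball 0 1))"
    "\<And>x. norm x \<le> 1 \<Longrightarrow> blinfun_apply T x \<in> closure (blinfun_apply T ` cball 0 1)"
  using assms closure_subset[of "blinfun_apply T ` cball 0 1"] by (auto simp: compact_operator_def)

lemma compact_operator_zero: "compact_operator 0"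
  by (rule compact_operatorI[of _ "{0}"]) (auto simp: bounded_operators_zero)

lemma compact_operator_add:
  assumes "compact_operator S" "compact_operator T"
  shows "compact_operator (S + T)"
proof (rule compact_operatorI[OF bounded_operators_add compact_sums[OF
      compact_operatorD(2)[OF assms(1)] compact_operatorD(2)[OF assms(2)]]])
  show "blinfun_apply (S + T) ` cball 0 1 \<subseteq> {x + y |x y. x \<in> closure (blinfun_apply S ` cball 0 1) \<and>
      y \<in> closure (blinfun_apply T ` cball 0 1)}"
    using compact_operatorD(3)[OF assms(1)] compact_operatorD(3)[OF assms(2)]
    by (force simp: blinfun.add_left)
qed (rule compact_operatorD(1)[OF assms(1)] compact_operatorD(1)[OF assms(2)])+

lemma compact_operator_compose_left:
  assumes "S \<in> bounded_operators" "compact_operator T"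
  shows "compact_operator (S o\<^sub>L T)"
  by (rule compact_operatorI[OF bounded_operators_compose compact_continuous_image[OF
        linear_continuous_on[OF blinfun.bounded_linear_right] compact_operatorD(2)[OF assms(2)]]])
     (use assms(1) compact_operatorD[OF assms(2)] in auto)

lemma compact_operator_scaleR:
  assumes "compact_operator T"
  shows "compact_operator (r *\<^sub>R T)"
  by (rule compact_operatorI[OF bounded_operators_scaleR compact_scaling[OF
        compact_operatorD(2)[OF assms]]])
     (use compact_operatorD[OF assms] in \<open>auto simp: blinfun.scaleR_left\<close>)

lemma compact_operator_sum:
  "(\<And>i. i \<in> I \<Longrightarrow> compact_operator (T i)) \<Longrightarrow> compact_operator (\<Sum>i\<in>I. T i)"
  by (induction I rule: infinite_finite_induct)
     (simp_all add: compact_operator_zero compact_operator_add)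

lemma compact_operator_convergent_subsequence:
  assumes "compact_operator T" "\<And>k. norm (x k) \<le> 1"
  obtains l and s :: "nat \<Rightarrow> nat" where "strict_mono s" "(\<lambda>k. blinfun_apply T (x (s k))) \<longlonglongrightarrow> l"
proof -
  have "\<forall>k. blinfun_apply T (x k) \<in> closure (blinfun_apply T ` cball 0 1)"
    using compact_operatorD(3)[OF assms(1)] assms(2) by blast
  with compact_operatorD(2)[OF assms(1)] obtain l s
    where "strict_mono s" "((\<lambda>k. blinfun_apply T (x k)) \<circ> s) \<longlonglongrightarrow> l"
    unfolding compact_def by metis
  thus ?thesis using that by (simp add: comp_def)
qed

section \<open>Positive operators\<close>

definition positive_operator :: "('a::complex_hilbert_space \<Rightarrow>\<^sub>L 'a) \<Rightarrow> bool"
  where "positive_operator T \<longleftrightarrow> T \<in> bounded_operators \<and>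
    (\<forall>x y. cinner (blinfun_apply T x) y = cinner x (blinfun_apply T y)) \<and>
    (\<forall>x. 0 \<le> inner (blinfun_apply T x) x)"

lemma positive_operatorD:
  assumes "positive_operator T"
  shows "T \<in> bounded_operators" "cinner (blinfun_apply T x) y = cinner x (blinfun_apply T y)"
    "inner (blinfun_apply T x) y = inner x (blinfun_apply T y)" "0 \<le> inner (blinfun_apply T x) x"
  using assms by (auto simp: positive_operator_def inner_eq_Re_cinner)

lemma positive_operator_scaleR:
  "positive_operator T \<Longrightarrow> 0 \<le> r \<Longrightarrow> positive_operator (r *\<^sub>R T)"
  by (simp add: positive_operator_def bounded_operators_scaleR blinfun.scaleR_left
    cinner_scaleR_left cinner_scaleR_right)

lemma positive_operator_sum:
  assumes "\<And>i. i \<in> I \<Longrightarrow> positive_operator (T i)"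
  shows "positive_operator (\<Sum>i\<in>I. T i)"
  using assms
  by (auto simp: positive_operator_def blinfun.sum_left cinner_sum_left cinner_sum_right
    inner_sum_left intro!: bounded_operators_sum sum_nonneg)

lemma inner_adj_compose:
  assumes "A \<in> bounded_operators"
  shows "inner (blinfun_apply (adj A o\<^sub>L A) x) x = (norm (blinfun_apply A x))\<^sup>2"
  using cinner_adj_right[OF assms, of x "blinfun_apply A x"]
  by (subst inner_commute) (simp add: inner_eq_Re_cinner cinner_self)

lemma positive_operator_adj_compose:
  assumes "A \<in> bounded_operators"
  shows "positive_operator (adj A o\<^sub>L A)"
proof -
  have "cinner (blinfun_apply (adj A) (blinfun_apply A x)) y =
      cinner x (blinfun_apply (adj A) (blinfun_apply A y))" for x y
    using cinner_adj_right[OF assms] by (metis cinner_commute)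
  thus ?thesis
    using bounded_operators_compose[OF adj_bounded_operators[OF assms] assms]
      inner_adj_compose[OF assms] by (simp add: positive_operator_def)
qed

text \<open>Positivity is tested at \<open>m x - T x\<close>. This gives
  \<open>T^2 \<le> m T\<close> at \<open>x\<close> from a bound on the quadratic form at the single
  vector \<open>T x\<close>.\<close>

lemma positive_operator_norm_power2_le:
  assumes T: "positive_operator T" and m: "0 < m"
    and le: "inner (blinfun_apply T (blinfun_apply T x)) (blinfun_apply T x) \<le> m * (norm (blinfun_apply T x))\<^sup>2"
  shows "(norm (blinfun_apply T x))\<^sup>2 \<le> m * inner (blinfun_apply T x) x"
proof -
  define y where "y = blinfun_apply T x"
  define v where "v = m *\<^sub>R x - y"
  have "0 \<le> inner (blinfun_apply T v) v" by (rule positive_operatorD(4)[OF T])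
  also have "\<dots> = m * (m * inner y x) - 2 * (m * inner y y) + inner (blinfun_apply T y) y"
    using positive_operatorD(3)[OF T, of y x]
    by (simp add: v_def y_def[symmetric] blinfun.diff_right blinfun.scaleR_right inner_diff_left
      inner_diff_right algebra_simps)
  also have "\<dots> \<le> m * (m * inner y x) - m * (norm y)\<^sup>2"
    using le by (simp add: y_def[symmetric] power2_norm_eq_inner)
  finally have "m * (norm y)\<^sup>2 \<le> m * (m * inner y x)" by simp
  thus ?thesis using m by (simp add: y_def)
qed

text \<open>The supremum \<open>m\<close> of the quadratic form on the unit sphere of the invariant
  subspace \<open>N\<close> is an eigenvalue: along a maximizing sequence \<open>T x - m x\<close>
  tends to 0, and compactness supplies a convergent subsequence of \<open>T x\<close>.\<close>

lemma compact_positive_operator_eigenvector: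
  assumes T: "compact_operator T" "positive_operator T"
    and N: "closed N" "subspace N" "\<And>x. x \<in> N \<Longrightarrow> blinfun_apply T x \<in> N" "x0 \<in> N" "x0 \<noteq> 0"
  obtains e \<mu> where "e \<in> N" "norm e = 1" "0 \<le> \<mu>" "blinfun_apply T e = \<mu> *\<^sub>R e"
proof -
  define Q where "Q = (\<lambda>x. inner (blinfun_apply T x) x)"
  define U where "U = {x \<in> N. norm x = 1}"
  define m where "m = Sup (Q ` U)"
  have "(1 / norm x0) *\<^sub>R x0 \<in> U"
    using N(2,4,5) by (simp add: U_def subspace_scale)
  hence U: "U \<noteq> {}" by auto
  have "Q x \<le> norm T" if "x \<in> U" for x
  proof -
    have "Q x \<le> norm (blinfun_apply T x) * norm x" unfolding Q_def by (rule norm_cauchy_schwarz)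
    also have "\<dots> \<le> norm T" using norm_blinfun[of T x] that by (simp add: U_def)
    finally show ?thesis .
  qed
  hence bdd: "bdd_above (Q ` U)" by (auto simp: bdd_above_def)
  have Qm: "Q x \<le> m" if "x \<in> U" for x
    unfolding m_def using that bdd by (intro cSup_upper) auto
  have Q0: "0 \<le> Q x" for x unfolding Q_def by (rule positive_operatorD(4)[OF T(2)])
  have m0: "0 \<le> m" using Qm U Q0 by (meson ex_in_conv order_trans)
  have form: "Q x \<le> m * (norm x)\<^sup>2" if "x \<in> N" for x
  proof (cases "x = 0")
    case False
    hence "(1 / norm x) *\<^sub>R x \<in> U" using N(2) that by (simp add: U_def subspace_scale)
    from Qm[OF this] False show ?thesis
      by (simp add: Q_def blinfun.scaleR_right field_simps power2_eq_square)
  qed (simp add: Q_def)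
  show ?thesis
  proof (cases "m = 0")
    case True
    from U obtain e where e: "e \<in> U" by blast
    have TeN: "blinfun_apply T e \<in> N" using e N(3) by (simp add: U_def)
    \<comment> \<open>\<open>positive_operator_norm_power2_le\<close> asks for a positive constant;
      1 serves, because the form at \<open>T e\<close> is at most 0.\<close>
    have "(norm (blinfun_apply T e))\<^sup>2 \<le> 1 * inner (blinfun_apply T e) e"
      using form[OF TeN] True Q0 unfolding Q_def
      by (intro positive_operator_norm_power2_le[OF T(2)]) (auto intro: order_trans[of _ 0])
    moreover have "inner (blinfun_apply T e) e \<le> 0" using Qm[OF e] True by (simp add: Q_def)
    ultimately have "blinfun_apply T e = 0"
      by (metis mult_1 norm_eq_zero order_antisym order_trans zero_eq_power2 zero_le_power2)
    thus ?thesis using e that[of e 0] by (simp add: U_def)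
  next
    case False
    hence m: "0 < m" using m0 by simp
    have "\<exists>x\<in>U. m - 1 / real (Suc k) < Q x" for k
    proof -
      have "m - 1 / real (Suc k) < Sup (Q ` U)" by (simp add: m_def)
      thus ?thesis using less_cSup_iff[of "Q ` U"] bdd U by auto
    qed
    then obtain x where xU: "\<And>k. x k \<in> U" and x: "\<And>k. m - 1 / real (Suc k) < Q (x k)" by metis
    have Qlim: "(\<lambda>k. Q (x k)) \<longlonglongrightarrow> m"
    proof (rule tendsto_sandwich)
      show "(\<lambda>k. m - 1 / real (Suc k)) \<longlonglongrightarrow> m"
        using tendsto_diff[OF tendsto_const LIMSEQ_Suc[OF lim_const_over_n[of 1]], of m] by simp
      show "(\<lambda>k. m) \<longlonglongrightarrow> m" by simp
    qed (intro always_eventually allI less_imp_le[OF x] Qm[OF xU])+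
    have almost: "(norm (blinfun_apply T (x k) - m *\<^sub>R x k))\<^sup>2 \<le> m * (m - Q (x k))" for k
    proof -
      have xk: "x k \<in> N" "norm (x k) = 1" using xU by (auto simp: U_def)
      have "(norm (blinfun_apply T (x k) - m *\<^sub>R x k))\<^sup>2
          = (norm (blinfun_apply T (x k)))\<^sup>2 - 2 * m * Q (x k) + m * m * (norm (x k))\<^sup>2"
        by (simp add: power2_norm_eq_inner inner_diff_left inner_diff_right Q_def inner_commute
          algebra_simps)
      also have "(norm (blinfun_apply T (x k)))\<^sup>2 \<le> m * Q (x k)"
        using form[OF N(3)[OF xk(1)]] unfolding Q_def
        by (rule positive_operator_norm_power2_le[OF T(2) m])
      finally show ?thesis using xk by (simp add: algebra_simps)
    qed
    have "norm (x k) \<le> 1" for k using xU by (simp add: U_def)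
    then obtain l s where s: "strict_mono (s :: nat \<Rightarrow> nat)"
      and l: "(\<lambda>k. blinfun_apply T (x (s k))) \<longlonglongrightarrow> l"
      using compact_operator_convergent_subsequence[OF T(1), of x] by metis
    have "(\<lambda>k. (norm (blinfun_apply T (x k) - m *\<^sub>R x k))\<^sup>2) \<longlonglongrightarrow> 0"
    proof (rule tendsto_sandwich[OF _ _ tendsto_const])
      show "(\<lambda>k. m * (m - Q (x k))) \<longlonglongrightarrow> 0"
        using tendsto_mult[OF tendsto_const tendsto_diff[OF tendsto_const Qlim], of m m] by simp
    qed (auto intro!: always_eventually almost)
    hence "(\<lambda>k. norm (blinfun_apply T (x k) - m *\<^sub>R x k)) \<longlonglongrightarrow> 0"
      using tendsto_real_sqrt by fastforce
    hence "(\<lambda>k. blinfun_apply T (x k) - m *\<^sub>R x k) \<longlonglongrightarrow> 0" by (rule tendsto_norm_zero_cancel)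
    hence "(\<lambda>k. blinfun_apply T (x (s k)) - m *\<^sub>R x (s k)) \<longlonglongrightarrow> 0"
      using LIMSEQ_subseq_LIMSEQ[OF _ s] by (fastforce simp: comp_def)
    \<comment> \<open>As \<open>T x\<close> converges along the subsequence, so does
      \<open>m x\<close>; the limit has norm \<open>m > 0\<close> and is therefore a nonzero
      eigenvector.\<close>
    from tendsto_diff[OF l this] have ml: "(\<lambda>k. m *\<^sub>R x (s k)) \<longlonglongrightarrow> l" by simp
    have "norm l = m"
    proof (rule LIMSEQ_unique[OF tendsto_norm[OF ml]])
      show "(\<lambda>k. norm (m *\<^sub>R x (s k))) \<longlonglongrightarrow> m" using xU m by (simp add: U_def)
    qed
    have "m *\<^sub>R x (s k) \<in> N" for k using xU N(2) by (simp add: U_def subspace_scale)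
    hence "l \<in> N" using closed_sequentially[OF N(1) _ ml] by blast
    have "blinfun_apply T l = m *\<^sub>R l"
    proof (rule LIMSEQ_unique)
      show "(\<lambda>k. blinfun_apply T (m *\<^sub>R x (s k))) \<longlonglongrightarrow> blinfun_apply T l"
        by (rule bounded_linear.tendsto[OF blinfun.bounded_linear_right ml])
      show "(\<lambda>k. blinfun_apply T (m *\<^sub>R x (s k))) \<longlonglongrightarrow> m *\<^sub>R l"
        unfolding blinfun.scaleR_right by (intro tendsto_intros l)
    qed
    show ?thesis
    proof (rule that[of "(1 / m) *\<^sub>R l" m])
      show "(1 / m) *\<^sub>R l \<in> N" using \<open>l \<in> N\<close> N(2) by (simp add: subspace_scale)
      show "norm ((1 / m) *\<^sub>R l) = 1" using \<open>norm l = m\<close> m by simp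
      show "blinfun_apply T ((1 / m) *\<^sub>R l) = m *\<^sub>R (1 / m) *\<^sub>R l"
        using \<open>blinfun_apply T l = m *\<^sub>R l\<close> m by (simp add: blinfun.scaleR_right)
    qed (rule m0)
  qed
qed

text \<open>Zorn's lemma gives a maximal orthonormal set of eigenvectors. Its orthogonal complement
  is invariant by symmetry of \<open>T\<close>; if it were nonzero it would contain a further unit
  eigenvector, against maximality.\<close>

theorem spectral_theorem_compact_positive:
  assumes T: "compact_operator T" "positive_operator T"
  obtains B \<mu> where "diagonalizes B \<mu> T"
proof -
  define eig where "eig = (\<lambda>e. \<exists>\<mu>\<ge>0. blinfun_apply T e = \<mu> *\<^sub>R e)"
  define \<A> where "\<A> = {B. orthonormal B \<and> (\<forall>e\<in>B. eig e)}"
  have "\<exists>M\<in>\<A>. \<forall>X\<in>\<A>. M \<subseteq> X \<longrightarrow> X = M"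
  proof (rule subset_Zorn')
    fix C assume C: "subset.chain \<A> C"
    have common: "\<exists>X\<in>C. e \<in> X \<and> f \<in> X" if "e \<in> \<Union> C" "f \<in> \<Union> C" for e f
    proof -
      from that obtain X Y where "X \<in> C" "e \<in> X" "Y \<in> C" "f \<in> Y" by blast
      moreover from this C have "X \<subseteq> Y \<or> Y \<subseteq> X" by (auto simp: subset_chain_def)
      ultimately show ?thesis by blast
    qed
    have mem: "orthonormal X" "\<And>e. e \<in> X \<Longrightarrow> eig e" if "X \<in> C" for X
      using C that by (auto simp: subset_chain_def \<A>_def)
    have "eig e \<and> norm e = 1" if "e \<in> \<Union> C" for e
      using that mem by (auto simp: orthonormal_def)
    moreover have "cinner e f = 0" if "e \<in> \<Union> C" "f \<in> \<Union> C" "e \<noteq> f" for e f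
      using common[OF that(1,2)] that(3) mem(1) by (auto simp: orthonormal_def)
    ultimately show "\<Union> C \<in> \<A>" unfolding \<A>_def orthonormal_def by blast
  qed
  then obtain M where M: "M \<in> \<A>" "\<And>X. X \<in> \<A> \<Longrightarrow> M \<subseteq> X \<Longrightarrow> X = M" by blast
  have on: "orthonormal M" "\<And>e. e \<in> M \<Longrightarrow> eig e" using M(1) by (auto simp: \<A>_def)
  define N where "N = {x. \<forall>e\<in>M. cinner x e = 0}"
  have "x = 0" if x: "x \<in> N" for x
  proof (rule ccontr)
    assume "x \<noteq> 0"
    have "closed N"
    proof -
      have "closed {x. cinner x e = 0}" for e :: 'a
        by (intro closed_Collect_eq continuous_intros
          linear_continuous_on[OF bounded_linear_cinner_left])
      moreover have "N = (\<Inter>e\<in>M. {x. cinner x e = 0})" by (auto simp: N_def)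
      ultimately show ?thesis by auto
    qed
    moreover have "subspace N"
      by (auto simp: N_def subspace_def cinner_add_left cinner_scaleR_left)
    moreover have "blinfun_apply T v \<in> N" if "v \<in> N" for v
      unfolding N_def
    proof (intro CollectI ballI)
      fix e assume e: "e \<in> M"
      then obtain \<mu> where "blinfun_apply T e = \<mu> *\<^sub>R e" using on(2) by (auto simp: eig_def)
      thus "cinner (blinfun_apply T v) e = 0"
        using that e by (simp add: positive_operatorD(2)[OF T(2)] cinner_scaleR_right N_def)
    qed
    ultimately obtain e \<mu> where e: "e \<in> N" "norm e = 1" "0 \<le> \<mu>" "blinfun_apply T e = \<mu> *\<^sub>R e"
      using compact_positive_operator_eigenvector[OF T] x \<open>x \<noteq> 0\<close> by metis
    have "cinner f e = 0" if "f \<in> M" for f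
      using e(1) that cinner_commute[of f e] by (simp add: N_def)
    hence "orthonormal (insert e M)"
      using on(1) e(1,2) by (auto simp: orthonormal_def N_def)
    hence "insert e M \<in> \<A>" using on(2) e(3,4) by (auto simp: \<A>_def eig_def)
    hence "e \<in> M" using M(2) by blast
    hence "cinner e e = 0" using e(1) by (simp add: N_def)
    thus False using e(2) by (simp add: cinner_self)
  qed
  hence "orthonormal_basis M"
    using on(1) by (simp add: orthonormal_basis_def orthonormal_def N_def)
  moreover obtain \<mu> where "\<And>e. e \<in> M \<Longrightarrow> 0 \<le> \<mu> e \<and> blinfun_apply T e = \<mu> e *\<^sub>R e"
    using on(2) unfolding eig_def by metis
  ultimately have "diagonalizes M \<mu> T"
    using positive_operatorD(1)[OF T(2)] by (simp add: diagonalizes_def)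
  thus ?thesis by (rule that)
qed

lemma compact_operator_diagonalizes_adj_compose:
  assumes "compact_operator A"
  shows "\<exists>B \<mu>. diagonalizes B \<mu> (adj A o\<^sub>L A)"
  using spectral_theorem_compact_positive[OF
    compact_operator_compose_left[OF adj_bounded_operators[OF compact_operatorD(1)[OF assms]] assms]
    positive_operator_adj_compose[OF compact_operatorD(1)[OF assms]]] by blast

section \<open>Eigenvalues under domination\<close>

lemma powr_le_tangent:
  fixes l m q :: real
  assumes "0 \<le> q" "q \<le> 1" "0 < m" "0 \<le> l"
  shows "l powr q \<le> (1 - q) * m powr q + q * m powr (q - 1) * l"
proof (cases "l = 0")
  case False
  hence l: "0 < l" using assms by simp
  \<comment> \<open>Weighted AM-GM for \<open>l / m\<close> and 1; multiplied by
    \<open>m powr q\<close> it becomes the tangent at \<open>m\<close> to the concave power.\<close>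
  have "(l / m) powr q * 1 powr (1 - q) \<le> q * (l / m) + (1 - q) * 1"
    using assms l by (intro Youngs_inequality_0) auto
  hence "(l / m) powr q * m powr q \<le> (q * (l / m) + (1 - q)) * m powr q"
    by (intro mult_right_mono) auto
  moreover have "(l / m) powr q * m powr q = l powr q"
    using l assms by (simp add: powr_divide)
  moreover have "m powr (q - 1) = m powr q / m" using assms by (simp add: powr_diff)
  ultimately show ?thesis by (simp add: algebra_simps)
\<comment> \<open>For \<open>l = 0\<close> the left side is 0 even when \<open>q = 0\<close>, since
  \<open>0 powr 0 = 0\<close>.\<close>
qed (use assms in simp)

text \<open>The tangent at \<open>m\<close> to a convex power, from weighted AM-GM with weight
  \<open>1 / q\<close> on \<open>(l / m) powr q\<close>.\<close>

lemma powr_ge_tangent: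
  fixes l m q :: real
  assumes "1 \<le> q" "0 < m" "0 \<le> l"
  shows "q * m powr (q - 1) * l \<le> l powr q + (q - 1) * m powr q"
proof (cases "l = 0")
  case False
  hence l: "0 < l" using assms by simp
  have "((l / m) powr q) powr (1 / q) * 1 powr (1 - 1 / q) \<le> 1 / q * (l / m) powr q + (1 - 1 / q) * 1"
    using assms l by (intro Youngs_inequality_0) auto
  hence "q * (l / m) \<le> q * (1 / q * (l / m) powr q + (1 - 1 / q))"
    using assms l by (intro mult_left_mono) (auto simp: powr_powr)
  also have "\<dots> = (l / m) powr q + (q - 1)" using assms by (simp add: field_simps)
  finally have "q * (l / m) \<le> (l / m) powr q + (q - 1)" .
  hence "q * (l / m) * m powr q \<le> ((l / m) powr q + (q - 1)) * m powr q"
    by (intro mult_right_mono) auto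
  moreover have "(l / m) powr q * m powr q = l powr q"
    using l assms by (simp add: powr_divide)
  moreover have "m powr (q - 1) = m powr q / m" using assms by (simp add: powr_diff)
  ultimately show ?thesis by (simp add: algebra_simps)
qed (use assms in simp)

text \<open>This is the tangent inequality at \<open>1 / l\<close> for the convex function
  \<open>t powr (- s)\<close>, evaluated at \<open>t = 1 / z\<close>.\<close>

lemma powr_plus_inverse_ge:
  fixes l z s :: real
  assumes "0 \<le> s" "0 < l" "0 < z"
  shows "(1 + s) * l powr s \<le> z powr s + s * l powr (s + 1) * inverse z"
proof -
  define x where "x = l / z"
  have x: "0 < x" using assms by (simp add: x_def)
  have "1 - s * ln x \<le> x powr - s"
    using exp_ge_add_one_self[of "- s * ln x"] x by (simp add: powr_def)
  moreover have "s * (1 + ln x) \<le> s * x"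
    using ln_le_minus_one[OF x] assms by (intro mult_left_mono) auto
  ultimately have "1 + s \<le> x powr - s + s * x" by (simp add: algebra_simps)
  hence "(1 + s) * l powr s \<le> (x powr - s + s * x) * l powr s" by (intro mult_right_mono) auto
  moreover have "x powr - s * l powr s = z powr s"
    using assms by (simp add: x_def powr_divide powr_minus field_simps)
  moreover have "l powr (s + 1) = l powr s * l" using assms by (simp add: powr_add)
  ultimately show ?thesis by (simp add: x_def algebra_simps divide_inverse)
qed

text \<open>The tangent inequalities at the mean \<open>M\<close> are summed over \<open>K\<close>;
  their linear parts add up exactly, because the deviations from the mean cancel.\<close>

lemma power_mean_powr:
  fixes m :: "'k \<Rightarrow> real"
  assumes K: "finite K" "K \<noteq> {}" and m: "\<And>k. k \<in> K \<Longrightarrow> 0 \<le> m k" and q: "0 < q"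
  shows power_mean_powr_le_one:
      "q \<le> 1 \<Longrightarrow> real (card K) powr (q - 1) * (\<Sum>k\<in>K. m k powr q) \<le> (\<Sum>k\<in>K. m k) powr q"
    and power_mean_powr_ge_one:
      "1 \<le> q \<Longrightarrow> (\<Sum>k\<in>K. m k) powr q \<le> real (card K) powr (q - 1) * (\<Sum>k\<in>K. m k powr q)"
proof -
  define n where "n = real (card K)"
  define M where "M = (\<Sum>k\<in>K. m k) / n"
  have n: "0 < n" using K by (simp add: n_def card_gt_0_iff)
  have sum_nM: "(\<Sum>k\<in>K. m k) = n * M" using n by (simp add: M_def)
  have M0: "0 \<le> M" unfolding M_def using m n by (simp add: sum_nonneg)
  have scale: "n powr (q - 1) * (n * M powr q) = (\<Sum>k\<in>K. m k) powr q"
    using n M0 by (simp add: sum_nM powr_mult powr_diff)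
  have M_powr: "M powr (q - 1) * M = M powr q" if "0 < M"
    using that by (simp add: powr_diff)
  \<comment> \<open>The tangent needs a positive base point, so a vanishing mean is treated apart:
    then every term is 0.\<close>
  have zero: "m k = 0" if "M = 0" "k \<in> K" for k
    using that sum_nM K m by (simp add: sum_nonneg_eq_0_iff)
  have sum_tangent: "(\<Sum>k\<in>K. q * M powr (q - 1) * m k) = q * (n * M powr q)" if "0 < M"
    unfolding sum_distrib_left[symmetric] sum_nM M_powr[OF that, symmetric] by simp
  {
    assume "q \<le> 1"
    have "(\<Sum>k\<in>K. m k powr q) \<le> n * M powr q"
    proof (cases "M = 0")
      case False
      hence M: "0 < M" using M0 by simp
      have "(\<Sum>k\<in>K. m k powr q) \<le> (\<Sum>k\<in>K. (1 - q) * M powr q + q * M powr (q - 1) * m k)"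
        using q \<open>q \<le> 1\<close> M m by (intro sum_mono powr_le_tangent) auto
      also have "\<dots> = n * M powr q"
        unfolding sum.distrib sum_tangent[OF M] by (simp add: n_def algebra_simps)
      finally show ?thesis .
    qed (use zero in simp)
    from mult_left_mono[OF this, of "n powr (q - 1)"]
    show "real (card K) powr (q - 1) * (\<Sum>k\<in>K. m k powr q) \<le> (\<Sum>k\<in>K. m k) powr q"
      unfolding scale by (simp add: n_def)
  }
  {
    assume "1 \<le> q"
    have "n * M powr q \<le> (\<Sum>k\<in>K. m k powr q)"
    proof (cases "M = 0")
      case False
      hence M: "0 < M" using M0 by simp
      have "q * (n * M powr q) \<le> (\<Sum>k\<in>K. m k powr q + (q - 1) * M powr q)"
        unfolding sum_tangent[OF M, symmetric]
        using \<open>1 \<le> q\<close> M m by (intro sum_mono powr_ge_tangent) auto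
      also have "\<dots> = (\<Sum>k\<in>K. m k powr q) + (q - 1) * (n * M powr q)"
        by (simp add: sum.distrib n_def)
      finally show ?thesis by (simp add: algebra_simps)
    qed (use zero in simp)
    from mult_left_mono[OF this, of "n powr (q - 1)"]
    show "(\<Sum>k\<in>K. m k) powr q \<le> real (card K) powr (q - 1) * (\<Sum>k\<in>K. m k powr q)"
      unfolding scale by (simp add: n_def)
  }
qed

text \<open>The trace of the \<open>q\<close>-th power of an operator with eigenbasis
  \<open>B\<close> and eigenvalues \<open>\<mu>\<close>.\<close>

definition eigensum :: "real \<Rightarrow> 'b set \<Rightarrow> ('b \<Rightarrow> real) \<Rightarrow> ennreal"
  where "eigensum q B \<mu> = (\<Sum>\<^sub>\<infinity>f\<in>B. ennreal (\<mu> f powr q))"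

section \<open>Spectral weights of an eigenvector with respect to a dominating operator\<close>

lemma diagonalizes_inner_eigenvector:
  assumes "diagonalizes B \<mu> T" "e \<in> B"
  shows "inner (blinfun_apply T e) e = \<mu> e"
  using diagonalizesD[OF assms(1)] assms(2)
  by (simp add: power2_norm_eq_inner[symmetric])

lemma diagonalizes_inner_nonneg:
  assumes "diagonalizes B \<mu> T"
  shows "0 \<le> inner (blinfun_apply T x) x"
  by (rule has_sum_nonneg[OF diagonalizes_quadratic_form[OF assms]])
     (simp add: diagonalizesD(3)[OF assms])

lemma diagonalizes_inner_ge:
  assumes "diagonalizes B \<mu> T" "f \<in> B"
  shows "\<mu> f * (cmod (cinner x f))\<^sup>2 \<le> inner (blinfun_apply T x) x"
  using finite_sum_le_has_sum[OF diagonalizes_quadratic_form[OF assms(1), of x], of "{f}"] assms(2)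
  by (simp add: diagonalizesD(3)[OF assms(1)])

text \<open>For invertible \<open>Z \<ge> Y\<close> this is \<open>\<langle>Z\<^sup>-\<^sup>1 f, f\<rangle> \<le> \<langle>Y\<^sup>-\<^sup>1 f, f\<rangle> = 1 / \<mu> f\<close>; the vector \<open>x\<close> of the proof is a
  finite section of \<open>Z\<^sup>-\<^sup>1 f\<close>.\<close>

lemma sum_inverse_eigenvalues_le:
  assumes Y: "diagonalizes B \<mu> Y" and Z: "diagonalizes C \<zeta> Z"
    and le: "\<And>x. inner (blinfun_apply Y x) x \<le> inner (blinfun_apply Z x) x"
    and f: "f \<in> B" "0 < \<mu> f" and F: "finite F" "F \<subseteq> C"
  shows "(\<Sum>e\<in>F. (cmod (cinner f e))\<^sup>2 * inverse (\<zeta> e)) \<le> 1 / \<mu> f"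
proof -
  define a where "a = (\<Sum>e\<in>F. (cmod (cinner f e))\<^sup>2 * inverse (\<zeta> e))"
  define c where "c = (\<lambda>e. cinner f e * complex_of_real (inverse (\<zeta> e)))"
  define x where "x = (\<Sum>e\<in>F. c e *\<^sub>C e)"
  have on: "orthonormal F"
    by (rule orthonormal_subset[OF orthonormal_basis_orthonormal[OF diagonalizesD(1)[OF Z]] F(2)])
  have a0: "0 \<le> a"
    unfolding a_def using F(2) diagonalizesD(3)[OF Z] by (intro sum_nonneg) auto
  have fx: "cinner f x = complex_of_real a"
    unfolding x_def a_def cinner_sum_right of_real_sum
    by (intro sum.cong refl)
      (simp add: cinner_scaleC_right c_def mult_ac mult_cnj_cmod[unfolded of_real_power])
  have xe: "cinner x e = c e" if "e \<in> F" for e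
    unfolding x_def by (rule cinner_orthonormal_sum[OF F(1) on that])
  have Zx: "blinfun_apply Z x = (\<Sum>e\<in>F. (c e * complex_of_real (\<zeta> e)) *\<^sub>C e)"
    unfolding x_def blinfun.sum_right using F(2)
    by (intro sum.cong refl)
      (auto simp: bounded_operators_scaleC diagonalizesD[OF Z] scaleR_eq_scaleC scaleC_scaleC)
  have "cinner (blinfun_apply Z x) x = (\<Sum>e\<in>F. c e * complex_of_real (\<zeta> e) * cinner e x)"
    unfolding Zx cinner_sum_left by (simp add: cinner_scaleC_left)
  also have "\<dots> = complex_of_real a"
    unfolding a_def of_real_sum
  proof (intro sum.cong refl)
    fix e assume e: "e \<in> F"
    have "c e * complex_of_real (\<zeta> e) * cinner e x
        = cinner f e * cnj (cinner f e) * complex_of_real (inverse (\<zeta> e) * \<zeta> e * inverse (\<zeta> e))"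
      using xe[OF e] cinner_commute[of e x] by (simp add: c_def mult_ac)
    \<comment> \<open>The convention \<open>inverse 0 = 0\<close> keeps this valid on the kernel of
      \<open>Z\<close>.\<close>
    also have "inverse (\<zeta> e) * \<zeta> e * inverse (\<zeta> e) = inverse (\<zeta> e)"
      by (cases "\<zeta> e = 0") auto
    finally show "c e * complex_of_real (\<zeta> e) * cinner e x
        = complex_of_real ((cmod (cinner f e))\<^sup>2 * inverse (\<zeta> e))"
      by (simp only: mult_cnj_cmod of_real_mult)
  qed
  finally have Za: "inner (blinfun_apply Z x) x = a" by (simp add: inner_eq_Re_cinner)
  \<comment> \<open>At \<open>x\<close> the form of \<open>Z\<close> is \<open>a\<close> and that of
    \<open>Y\<close> is at least \<open>\<mu> f * a\<^sup>2\<close>, so domination forces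
    \<open>\<mu> f * a \<le> 1\<close>.\<close>
  have "\<mu> f * (cmod (cinner x f))\<^sup>2 \<le> a"
    using diagonalizes_inner_ge[OF Y f(1), of x] le[of x] Za by simp
  hence "\<mu> f * a * a \<le> 1 * a"
    using fx by (simp add: cmod_cinner_commute[of x f] power2_eq_square mult_ac)
  hence "\<mu> f * a \<le> 1" using a0 by (cases "a = 0") auto
  thus ?thesis using f(2) unfolding a_def[symmetric] by (simp add: field_simps)
qed

lemma infsum_inverse_eigenvalues_le:
  assumes Y: "diagonalizes B \<mu> Y" and Z: "diagonalizes C \<zeta> Z"
    and le: "\<And>x. inner (blinfun_apply Y x) x \<le> inner (blinfun_apply Z x) x"
    and f: "f \<in> B" "0 < \<mu> f"
  shows "(\<Sum>\<^sub>\<infinity>e\<in>C. ennreal ((cmod (cinner f e))\<^sup>2 * inverse (\<zeta> e))) \<le> ennreal (1 / \<mu> f)"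
proof (rule infsum_le_finite_sums[OF ennreal_summable_on])
  fix F assume F: "finite F" "F \<subseteq> C"
  have "(\<Sum>e\<in>F. ennreal ((cmod (cinner f e))\<^sup>2 * inverse (\<zeta> e)))
      = ennreal (\<Sum>e\<in>F. (cmod (cinner f e))\<^sup>2 * inverse (\<zeta> e))"
    using F diagonalizesD(3)[OF Z] by (intro sum_ennreal) auto
  also have "\<dots> \<le> ennreal (1 / \<mu> f)"
    by (intro ennreal_leI sum_inverse_eigenvalues_le[OF assms F])
  finally show "(\<Sum>e\<in>F. ennreal ((cmod (cinner f e))\<^sup>2 * inverse (\<zeta> e))) \<le> ennreal (1 / \<mu> f)" .
qed

text \<open>Domination makes the form of \<open>Y\<close> vanish on the kernel of \<open>Z\<close>.
  This settles the terms with \<open>\<zeta> e = 0\<close>, to which the scalar inequalities do not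
  apply.\<close>

lemma cinner_eq_0_if_dominating_eigenvalue_0:
  assumes Y: "diagonalizes B \<mu> Y" and Z: "diagonalizes C \<zeta> Z"
    and le: "\<And>x. inner (blinfun_apply Y x) x \<le> inner (blinfun_apply Z x) x"
    and f: "f \<in> B" "0 < \<mu> f" and e: "e \<in> C" "\<zeta> e = 0"
  shows "cinner f e = 0"
proof -
  have "\<mu> f * (cmod (cinner e f))\<^sup>2 \<le> 0"
    using diagonalizes_inner_ge[OF Y f(1), of e] le[of e] diagonalizes_inner_eigenvector[OF Z e(1)] e(2)
    by simp
  hence "cmod (cinner e f) = 0" using f(2) by (simp add: mult_le_0_iff)
  thus ?thesis by (metis cmod_cinner_commute norm_eq_zero)
qed

text \<open>\<open>powr_plus_inverse_ge\<close> with \<open>l = \<mu> f\<close> is averaged over the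
  spectral weights \<open>w\<close>, which sum to 1; the average of
  \<open>inverse (\<zeta> e)\<close> is at most \<open>1 / \<mu> f\<close>.\<close>

lemma infsum_powr_eigenvector_ge:
  assumes Y: "diagonalizes B \<mu> Y" and Z: "diagonalizes C \<zeta> Z"
    and le: "\<And>x. inner (blinfun_apply Y x) x \<le> inner (blinfun_apply Z x) x"
    and f: "f \<in> B" "0 < \<mu> f" and s: "0 \<le> s"
  shows "ennreal (\<mu> f powr s) \<le> (\<Sum>\<^sub>\<infinity>e\<in>C. ennreal ((cmod (cinner f e))\<^sup>2 * \<zeta> e powr s))"
    (is "_ \<le> ?S")
proof -
  define w where "w = (\<lambda>e. (cmod (cinner f e))\<^sup>2)"
  have "(w has_sum 1) C"
    using parseval[OF diagonalizesD(1)[OF Z], of f] diagonalizesD(5)[OF Y f(1)]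
    by (simp add: w_def)
  from has_sum_cmult_right[OF this, of "(1 + s) * \<mu> f powr s"]
  have sum_w: "(\<Sum>\<^sub>\<infinity>e\<in>C. ennreal ((1 + s) * \<mu> f powr s * w e)) = ennreal ((1 + s) * \<mu> f powr s)"
    by (intro infsum_ennreal_eq) (use s in \<open>auto simp: w_def\<close>)
  have pointwise: "ennreal ((1 + s) * \<mu> f powr s * w e)
      \<le> ennreal (w e * \<zeta> e powr s) + ennreal (s * \<mu> f powr (s + 1)) * ennreal (w e * inverse (\<zeta> e))"
    if e: "e \<in> C" for e
  proof -
    have "(1 + s) * \<mu> f powr s * w e \<le> w e * \<zeta> e powr s + s * \<mu> f powr (s + 1) * (w e * inverse (\<zeta> e))"
    proof (cases "\<zeta> e = 0")
      case True
      thus ?thesis using cinner_eq_0_if_dominating_eigenvalue_0[OF Y Z le f e] by (simp add: w_def)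
    next
      case False
      hence "(1 + s) * \<mu> f powr s \<le> \<zeta> e powr s + s * \<mu> f powr (s + 1) * inverse (\<zeta> e)"
        using s f diagonalizesD(3)[OF Z e] by (intro powr_plus_inverse_ge) auto
      from mult_left_mono[OF this, of "w e"] show ?thesis
        by (simp add: w_def algebra_simps)
    qed
    thus ?thesis
      using s diagonalizesD(3)[OF Z e]
      by (simp add: w_def ennreal_plus[symmetric] ennreal_mult[symmetric] ennreal_leI
        del: ennreal_plus)
  qed
  \<comment> \<open>The summand \<open>s * \<mu> f powr s\<close> reappears on the right as the
    bound for the inverse term; being finite, it can be cancelled in \<open>ennreal\<close>.\<close>
  have "ennreal (\<mu> f powr s) + ennreal (s * \<mu> f powr s) = ennreal ((1 + s) * \<mu> f powr s)"
    using s by (simp add: ennreal_plus[symmetric] algebra_simps del: ennreal_plus)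
  also have "\<dots> \<le> (\<Sum>\<^sub>\<infinity>e\<in>C. ennreal (w e * \<zeta> e powr s)
      + ennreal (s * \<mu> f powr (s + 1)) * ennreal (w e * inverse (\<zeta> e)))"
    unfolding sum_w[symmetric] by (intro infsum_mono ennreal_summable_on pointwise)
  also have "\<dots> = ?S + ennreal (s * \<mu> f powr (s + 1)) * (\<Sum>\<^sub>\<infinity>e\<in>C. ennreal (w e * inverse (\<zeta> e)))"
    by (simp add: infsum_add ennreal_summable_on infsum_cmult_ennreal w_def)
  also have "\<dots> \<le> ?S + ennreal (s * \<mu> f powr (s + 1)) * ennreal (1 / \<mu> f)"
    unfolding w_def by (intro add_left_mono mult_left_mono infsum_inverse_eigenvalues_le[OF Y Z le f]) auto
  also have "ennreal (s * \<mu> f powr (s + 1)) * ennreal (1 / \<mu> f) = ennreal (s * \<mu> f powr s)"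
    using s f by (simp add: ennreal_mult[symmetric] powr_add)
  finally show ?thesis by (simp add: add.commute ennreal_add_left_cancel_le)
qed

text \<open>Jensen's inequality for the concave function \<open>y powr t\<close> of
  \<open>y = inverse (\<zeta> e)\<close>, whose average is at most
  \<open>1 / \<mu> f\<close>.\<close>

lemma infsum_powr_eigenvector_le:
  assumes Y: "diagonalizes B \<mu> Y" and Z: "diagonalizes C \<zeta> Z"
    and le: "\<And>x. inner (blinfun_apply Y x) x \<le> inner (blinfun_apply Z x) x"
    and f: "f \<in> B" "0 < \<mu> f" and t: "0 \<le> t" "t \<le> 1"
  shows "(\<Sum>\<^sub>\<infinity>e\<in>C. ennreal ((cmod (cinner f e))\<^sup>2 * \<zeta> e powr (- t))) \<le> ennreal (\<mu> f powr (- t))"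
    (is "?S \<le> _")
proof -
  define w where "w = (\<lambda>e. (cmod (cinner f e))\<^sup>2)"
  have "(w has_sum 1) C"
    using parseval[OF diagonalizesD(1)[OF Z], of f] diagonalizesD(5)[OF Y f(1)]
    by (simp add: w_def)
  from has_sum_cmult_right[OF this, of "(1 - t) * \<mu> f powr (- t)"]
  have sum_w: "(\<Sum>\<^sub>\<infinity>e\<in>C. ennreal ((1 - t) * \<mu> f powr (- t) * w e)) = ennreal ((1 - t) * \<mu> f powr (- t))"
    by (intro infsum_ennreal_eq) (use t in \<open>auto simp: w_def\<close>)
  have pointwise: "ennreal (w e * \<zeta> e powr (- t)) \<le> ennreal ((1 - t) * \<mu> f powr (- t) * w e)
      + ennreal (t * \<mu> f powr (1 - t)) * ennreal (w e * inverse (\<zeta> e))"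
    if e: "e \<in> C" for e
  proof -
    have "w e * \<zeta> e powr (- t)
        \<le> (1 - t) * \<mu> f powr (- t) * w e + t * \<mu> f powr (1 - t) * (w e * inverse (\<zeta> e))"
    proof (cases "\<zeta> e = 0")
      case True
      thus ?thesis using cinner_eq_0_if_dominating_eigenvalue_0[OF Y Z le f e] by (simp add: w_def)
    next
      case False
      hence z: "0 < \<zeta> e" using diagonalizesD(3)[OF Z e] by simp
      have inv: "inverse x powr r = x powr (- r)" if "0 < x" for x r :: real
        using that by (simp add: powr_minus inverse_powr)
      \<comment> \<open>The tangent is taken at \<open>inverse (\<mu> f)\<close>, so that the bound
        on the averaged inverses makes the two terms add up to
        \<open>\<mu> f powr (- t)\<close>.\<close>
      have "inverse (\<zeta> e) powr t \<le> (1 - t) * inverse (\<mu> f) powr t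
          + t * inverse (\<mu> f) powr (t - 1) * inverse (\<zeta> e)"
        using t f z by (intro powr_le_tangent) auto
      hence "\<zeta> e powr (- t) \<le> (1 - t) * \<mu> f powr (- t) + t * \<mu> f powr (1 - t) * inverse (\<zeta> e)"
        unfolding inv[OF z] inv[OF f(2)] by simp
      from mult_left_mono[OF this, of "w e"] show ?thesis
        by (simp add: w_def algebra_simps)
    qed
    thus ?thesis
      using t diagonalizesD(3)[OF Z e]
      by (simp add: w_def ennreal_plus[symmetric] ennreal_mult[symmetric] ennreal_leI
        del: ennreal_plus)
  qed
  have "?S \<le> (\<Sum>\<^sub>\<infinity>e\<in>C. ennreal ((1 - t) * \<mu> f powr (- t) * w e)
      + ennreal (t * \<mu> f powr (1 - t)) * ennreal (w e * inverse (\<zeta> e)))"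
    unfolding w_def[symmetric] using pointwise
    by (intro infsum_mono ennreal_summable_on) (auto simp: w_def)
  also have "\<dots> = ennreal ((1 - t) * \<mu> f powr (- t))
      + ennreal (t * \<mu> f powr (1 - t)) * (\<Sum>\<^sub>\<infinity>e\<in>C. ennreal (w e * inverse (\<zeta> e)))"
    by (simp add: infsum_add ennreal_summable_on infsum_cmult_ennreal sum_w)
  also have "\<dots> \<le> ennreal ((1 - t) * \<mu> f powr (- t)) + ennreal (t * \<mu> f powr (1 - t)) * ennreal (1 / \<mu> f)"
    unfolding w_def by (intro add_left_mono mult_left_mono infsum_inverse_eigenvalues_le[OF Y Z le f]) auto
  also have "ennreal (t * \<mu> f powr (1 - t)) * ennreal (1 / \<mu> f) = ennreal (t * \<mu> f powr (- t))"
    using t f by (simp add: ennreal_mult[symmetric] powr_diff powr_minus field_simps)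
  also have "ennreal ((1 - t) * \<mu> f powr (- t)) + ennreal (t * \<mu> f powr (- t)) = ennreal (\<mu> f powr (- t))"
    using t by (subst ennreal_plus[symmetric]) (auto simp: algebra_simps intro!: mult_left_le_one_le)
  finally show ?thesis .
qed

section \<open>Trace inequalities\<close>

text \<open>Both sides compute the trace of \<open>Y\<close> weighted by the diagonal
  \<open>g\<close> on \<open>C\<close>: the left one in the eigenbasis of \<open>Y\<close>, the
  right one in \<open>C\<close>.\<close>

lemma infsum_quadratic_form_swap:
  assumes Y: "diagonalizes B \<mu> Y" and g: "\<And>e. e \<in> C \<Longrightarrow> 0 \<le> g e"
  shows "(\<Sum>\<^sub>\<infinity>f\<in>B. ennreal (\<mu> f) * (\<Sum>\<^sub>\<infinity>e\<in>C. ennreal ((cmod (cinner f e))\<^sup>2 * g e)))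
    = (\<Sum>\<^sub>\<infinity>e\<in>C. ennreal (g e * inner (blinfun_apply Y e) e))"
proof -
  have "(\<Sum>\<^sub>\<infinity>f\<in>B. ennreal (\<mu> f) * (\<Sum>\<^sub>\<infinity>e\<in>C. ennreal ((cmod (cinner f e))\<^sup>2 * g e)))
      = (\<Sum>\<^sub>\<infinity>f\<in>B. \<Sum>\<^sub>\<infinity>e\<in>C. ennreal (g e * (\<mu> f * (cmod (cinner e f))\<^sup>2)))"
    unfolding infsum_cmult_ennreal[symmetric]
    by (intro infsum_cong)
      (simp add: ennreal_mult[symmetric] diagonalizesD(3)[OF Y] g cmod_cinner_commute mult_ac)
  also have "\<dots> = (\<Sum>\<^sub>\<infinity>e\<in>C. \<Sum>\<^sub>\<infinity>f\<in>B. ennreal (g e * (\<mu> f * (cmod (cinner e f))\<^sup>2)))"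
    by (rule infsum_swap_ennreal)
  also have "\<dots> = (\<Sum>\<^sub>\<infinity>e\<in>C. ennreal (g e * inner (blinfun_apply Y e) e))"
    by (intro infsum_cong infsum_ennreal_eq has_sum_cmult_right diagonalizes_quadratic_form[OF Y])
      (simp add: diagonalizesD(3)[OF Y] g)
  finally show ?thesis .
qed

text \<open>The eigenvector estimates with \<open>s = q - 1\<close> or \<open>t = 1 - q\<close> are
  multiplied by \<open>\<mu> f\<close> and summed over \<open>B\<close>; exchanging the sums
  produces the trace of \<open>Z^(q-1) Y\<close>.\<close>

lemma eigensum_dominated:
  assumes Y: "diagonalizes B \<mu> Y" and Z: "diagonalizes C \<zeta> Z"
    and le: "\<And>x. inner (blinfun_apply Y x) x \<le> inner (blinfun_apply Z x) x" and q: "0 < q"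
  shows eigensum_dominated_le: "1 \<le> q \<Longrightarrow> eigensum q B \<mu>
      \<le> (\<Sum>\<^sub>\<infinity>e\<in>C. ennreal (\<zeta> e powr (q - 1) * inner (blinfun_apply Y e) e))"
    and eigensum_dominated_ge: "q \<le> 1 \<Longrightarrow>
      (\<Sum>\<^sub>\<infinity>e\<in>C. ennreal (\<zeta> e powr (q - 1) * inner (blinfun_apply Y e) e)) \<le> eigensum q B \<mu>"
proof -
  have eq: "ennreal (\<mu> f powr q) = ennreal (\<mu> f) * ennreal (\<mu> f powr (q - 1))" if "f \<in> B" for f
    using diagonalizesD(3)[OF Y that] by (cases "\<mu> f = 0") (simp_all add: ennreal_mult[symmetric] powr_diff)
  note swap = infsum_quadratic_form_swap[OF Y, of C "\<lambda>e. \<zeta> e powr (q - 1)", symmetric]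
  show "1 \<le> q \<Longrightarrow> eigensum q B \<mu>
      \<le> (\<Sum>\<^sub>\<infinity>e\<in>C. ennreal (\<zeta> e powr (q - 1) * inner (blinfun_apply Y e) e))"
    unfolding eigensum_def
  proof (subst swap, simp, intro infsum_mono ennreal_summable_on)
    fix f assume q: "1 \<le> q" and f: "f \<in> B"
    show "ennreal (\<mu> f powr q)
        \<le> ennreal (\<mu> f) * (\<Sum>\<^sub>\<infinity>e\<in>C. ennreal ((cmod (cinner f e))\<^sup>2 * \<zeta> e powr (q - 1)))"
    proof (cases "\<mu> f = 0")
      case False
      thus ?thesis unfolding eq[OF f] using q f diagonalizesD(3)[OF Y f]
        by (intro mult_left_mono infsum_powr_eigenvector_ge[OF Y Z le]) auto
    qed simp
  qed
  show "q \<le> 1 \<Longrightarrow>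
      (\<Sum>\<^sub>\<infinity>e\<in>C. ennreal (\<zeta> e powr (q - 1) * inner (blinfun_apply Y e) e)) \<le> eigensum q B \<mu>"
    unfolding eigensum_def
  proof (subst swap, simp, intro infsum_mono ennreal_summable_on)
    fix f assume q1: "q \<le> 1" and f: "f \<in> B"
    show "ennreal (\<mu> f) * (\<Sum>\<^sub>\<infinity>e\<in>C. ennreal ((cmod (cinner f e))\<^sup>2 * \<zeta> e powr (q - 1)))
        \<le> ennreal (\<mu> f powr q)"
    proof (cases "\<mu> f = 0")
      case False
      thus ?thesis unfolding eq[OF f] using q q1 f diagonalizesD(3)[OF Y f]
        using infsum_powr_eigenvector_le[OF Y Z le f, of "1 - q"]
        by (intro mult_left_mono) auto
    qed simp
  qed
qed

text \<open>At an eigenvector \<open>e\<close> of \<open>Z\<close> the forms of the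
  \<open>Y k\<close> add up to \<open>\<zeta> e\<close>, which raises the exponent from
  \<open>q - 1\<close> to \<open>q\<close>.\<close>

lemma infsum_powr_quadratic_form:
  assumes Y: "\<And>k. k \<in> K \<Longrightarrow> diagonalizes (B k) (\<mu> k) (Y k)" and Z: "diagonalizes C \<zeta> Z"
    and K: "finite K"
    and sum: "\<And>x. inner (blinfun_apply Z x) x = (\<Sum>k\<in>K. inner (blinfun_apply (Y k) x) x)"
  shows "(\<Sum>k\<in>K. \<Sum>\<^sub>\<infinity>e\<in>C. ennreal (\<zeta> e powr (q - 1) * inner (blinfun_apply (Y k) e) e))
    = eigensum q C \<zeta>"
  unfolding infsum_sum_ennreal[OF K] eigensum_def
proof (rule infsum_cong)
  fix e assume e: "e \<in> C"
  have "(\<Sum>k\<in>K. ennreal (\<zeta> e powr (q - 1) * inner (blinfun_apply (Y k) e) e))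
      = ennreal (\<zeta> e powr (q - 1) * inner (blinfun_apply Z e) e)"
    using diagonalizes_inner_nonneg[OF Y] by (simp add: sum_ennreal sum sum_distrib_left)
  also have "\<zeta> e powr (q - 1) * inner (blinfun_apply Z e) e = \<zeta> e powr q"
    using diagonalizesD(3)[OF Z e]
    by (cases "\<zeta> e = 0") (simp_all add: diagonalizes_inner_eigenvector[OF Z e] powr_diff)
  finally show "(\<Sum>k\<in>K. ennreal (\<zeta> e powr (q - 1) * inner (blinfun_apply (Y k) e) e))
      = ennreal (\<zeta> e powr q)" .
qed

text \<open>Every \<open>Y k\<close> is dominated by \<open>Z\<close>, and the comparison terms of
  \<open>eigensum_dominated\<close> add up exactly to the trace of the \<open>q\<close>-th power of
  \<open>Z\<close>.\<close>

theorem McCarthy: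
  assumes Y: "\<And>k. k \<in> K \<Longrightarrow> diagonalizes (B k) (\<mu> k) (Y k)" and Z: "diagonalizes C \<zeta> Z"
    and K: "finite K"
    and sum: "\<And>x. inner (blinfun_apply Z x) x = (\<Sum>k\<in>K. inner (blinfun_apply (Y k) x) x)"
    and q: "0 < q"
  shows McCarthy_superadditive: "1 \<le> q \<Longrightarrow> (\<Sum>k\<in>K. eigensum q (B k) (\<mu> k)) \<le> eigensum q C \<zeta>"
    and McCarthy_subadditive: "q \<le> 1 \<Longrightarrow> eigensum q C \<zeta> \<le> (\<Sum>k\<in>K. eigensum q (B k) (\<mu> k))"
proof -
  have le: "inner (blinfun_apply (Y k) x) x \<le> inner (blinfun_apply Z x) x" if "k \<in> K" for k x
    unfolding sum using diagonalizes_inner_nonneg[OF Y] K that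
    by (intro member_le_sum[of k K "\<lambda>k. inner (blinfun_apply (Y k) x) x"]) auto
  have eq: "eigensum q C \<zeta>
      = (\<Sum>k\<in>K. \<Sum>\<^sub>\<infinity>e\<in>C. ennreal (\<zeta> e powr (q - 1) * inner (blinfun_apply (Y k) e) e))"
    using infsum_powr_quadratic_form[OF Y Z K sum] by simp
  show "1 \<le> q \<Longrightarrow> (\<Sum>k\<in>K. eigensum q (B k) (\<mu> k)) \<le> eigensum q C \<zeta>"
    unfolding eq by (intro sum_mono eigensum_dominated_le[OF Y Z le q])
  show "q \<le> 1 \<Longrightarrow> eigensum q C \<zeta> \<le> (\<Sum>k\<in>K. eigensum q (B k) (\<mu> k))"
    unfolding eq by (intro sum_mono eigensum_dominated_ge[OF Y Z le q])
qed

section \<open>Jensen's inequality for traces of powers\<close>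

lemma quadratic_form_powr_le:
  assumes Y: "diagonalizes B \<mu> Y" and x: "norm x = 1" and q: "1 \<le> q"
  shows "ennreal (inner (blinfun_apply Y x) x powr q)
    \<le> (\<Sum>\<^sub>\<infinity>f\<in>B. ennreal (\<mu> f powr q * (cmod (cinner x f))\<^sup>2))"
proof (cases "inner (blinfun_apply Y x) x = 0")
  case False
  define m where "m = inner (blinfun_apply Y x) x"
  \<comment> \<open>The weights \<open>w\<close> form a probability distribution on the eigenvalues
    with mean \<open>m\<close>; the tangent at \<open>m\<close> is averaged against it.\<close>
  define w where "w = (\<lambda>f. (cmod (cinner x f))\<^sup>2)"
  have m: "0 < m" using False diagonalizes_inner_nonneg[OF Y, of x] by (simp add: m_def)
  have "(w has_sum 1) B" using parseval[OF diagonalizesD(1)[OF Y], of x] x by (simp add: w_def)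
  from has_sum_cmult_right[OF this, of "(q - 1) * m powr q"]
  have sum_w: "(\<Sum>\<^sub>\<infinity>f\<in>B. ennreal ((q - 1) * m powr q * w f)) = ennreal ((q - 1) * m powr q)"
    by (intro infsum_ennreal_eq) (use q in \<open>auto simp: w_def\<close>)
  have "((\<lambda>f. \<mu> f * w f) has_sum m) B"
    using diagonalizes_quadratic_form[OF Y, of x] by (simp add: w_def m_def)
  from has_sum_cmult_right[OF this, of "q * m powr (q - 1)"]
  have sum_mu: "(\<Sum>\<^sub>\<infinity>f\<in>B. ennreal (q * m powr (q - 1) * (\<mu> f * w f))) = ennreal (q * m powr q)"
    using m by (subst infsum_ennreal_eq)
      (use q m in \<open>auto simp: w_def diagonalizesD(3)[OF Y] powr_diff\<close>)
  have pointwise: "ennreal (q * m powr (q - 1) * (\<mu> f * w f))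
      \<le> ennreal (\<mu> f powr q * w f) + ennreal ((q - 1) * m powr q * w f)" if f: "f \<in> B" for f
  proof -
    have "q * m powr (q - 1) * \<mu> f * w f \<le> (\<mu> f powr q + (q - 1) * m powr q) * w f"
      using q m diagonalizesD(3)[OF Y f]
      by (intro mult_right_mono powr_ge_tangent) (auto simp: w_def)
    hence "q * m powr (q - 1) * (\<mu> f * w f) \<le> \<mu> f powr q * w f + (q - 1) * m powr q * w f"
      by (simp add: distrib_right mult.assoc)
    thus ?thesis using q
      by (simp add: w_def ennreal_plus[symmetric] ennreal_leI del: ennreal_plus)
  qed
  have "ennreal (m powr q) + ennreal ((q - 1) * m powr q) = ennreal (q * m powr q)"
    using q mult_right_mono[OF q, of "m powr q"]
    by (subst ennreal_plus[symmetric]) (auto simp: algebra_simps)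
  also have "\<dots> \<le> (\<Sum>\<^sub>\<infinity>f\<in>B. ennreal (\<mu> f powr q * w f) + ennreal ((q - 1) * m powr q * w f))"
    unfolding sum_mu[symmetric] by (intro infsum_mono ennreal_summable_on pointwise)
  also have "\<dots> = (\<Sum>\<^sub>\<infinity>f\<in>B. ennreal (\<mu> f powr q * w f)) + ennreal ((q - 1) * m powr q)"
    by (simp add: infsum_add ennreal_summable_on sum_w)
  finally show ?thesis by (simp add: add.commute ennreal_add_left_cancel_le m_def w_def)
qed simp

lemma quadratic_form_powr_ge:
  assumes Y: "diagonalizes B \<mu> Y" and x: "norm x = 1" and q: "0 < q" "q \<le> 1"
  shows "(\<Sum>\<^sub>\<infinity>f\<in>B. ennreal (\<mu> f powr q * (cmod (cinner x f))\<^sup>2))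
    \<le> ennreal (inner (blinfun_apply Y x) x powr q)"
proof (cases "inner (blinfun_apply Y x) x = 0")
  case True
  \<comment> \<open>A zero mean puts all spectral weight on zero eigenvalues; the tangent used in
    the other case needs a positive base point.\<close>
  have "\<mu> f powr q * (cmod (cinner x f))\<^sup>2 = 0" if f: "f \<in> B" for f
  proof -
    have "\<mu> f * (cmod (cinner x f))\<^sup>2 \<le> 0" using diagonalizes_inner_ge[OF Y f, of x] True by simp
    moreover have "0 \<le> \<mu> f * (cmod (cinner x f))\<^sup>2" using diagonalizesD(3)[OF Y f] by simp
    ultimately have "\<mu> f * (cmod (cinner x f))\<^sup>2 = 0" by (rule antisym)
    thus ?thesis using q by auto
  qed
  hence "(\<Sum>\<^sub>\<infinity>f\<in>B. ennreal (\<mu> f powr q * (cmod (cinner x f))\<^sup>2)) = 0"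
    by (intro infsum_0) simp
  thus ?thesis by simp
next
  case False
  define m where "m = inner (blinfun_apply Y x) x"
  define w where "w = (\<lambda>f. (cmod (cinner x f))\<^sup>2)"
  have m: "0 < m" using False diagonalizes_inner_nonneg[OF Y, of x] by (simp add: m_def)
  have "(w has_sum 1) B" using parseval[OF diagonalizesD(1)[OF Y], of x] x by (simp add: w_def)
  moreover have "((\<lambda>f. \<mu> f * w f) has_sum m) B"
    using diagonalizes_quadratic_form[OF Y, of x] by (simp add: w_def m_def)
  ultimately have "((\<lambda>f. (1 - q) * m powr q * w f + q * m powr (q - 1) * (\<mu> f * w f))
      has_sum ((1 - q) * m powr q * 1 + q * m powr (q - 1) * m)) B"
    by (intro has_sum_add has_sum_cmult_right)
  hence "(\<Sum>\<^sub>\<infinity>f\<in>B. ennreal ((1 - q) * m powr q * w f + q * m powr (q - 1) * (\<mu> f * w f)))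
      = ennreal ((1 - q) * m powr q * 1 + q * m powr (q - 1) * m)"
    by (rule infsum_ennreal_eq) (use q in \<open>auto simp: w_def diagonalizesD(3)[OF Y]\<close>)
  also have "(1 - q) * m powr q * 1 + q * m powr (q - 1) * m = m powr q"
    using m by (simp add: powr_diff algebra_simps)
  finally have sum: "(\<Sum>\<^sub>\<infinity>f\<in>B. ennreal ((1 - q) * m powr q * w f + q * m powr (q - 1) * (\<mu> f * w f)))
      = ennreal (m powr q)" .
  have "\<mu> f powr q * w f \<le> (1 - q) * m powr q * w f + q * m powr (q - 1) * (\<mu> f * w f)"
    if f: "f \<in> B" for f
  proof -
    have "\<mu> f powr q * w f \<le> ((1 - q) * m powr q + q * m powr (q - 1) * \<mu> f) * w f"
      using q m diagonalizesD(3)[OF Y f]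
      by (intro mult_right_mono powr_le_tangent) (auto simp: w_def)
    thus ?thesis by (simp add: algebra_simps)
  qed
  hence "(\<Sum>\<^sub>\<infinity>f\<in>B. ennreal (\<mu> f powr q * w f)) \<le> ennreal (m powr q)"
    unfolding sum[symmetric] by (intro infsum_mono ennreal_summable_on ennreal_leI)
  thus ?thesis by (simp add: m_def w_def)
qed

text \<open>Everything is compared at each \<open>e\<close> in the eigenbasis of \<open>Z\<close>:
  \<open>\<zeta> e\<close> is the sum of the diagonal entries \<open>Q k e\<close>, power means
  handle the sum over \<open>k\<close>, and Jensen's inequality compares \<open>Q k e powr q\<close>
  with \<open>J k e\<close>. Parseval shows that \<open>J k\<close> sums over \<open>C\<close> to
  the eigenvalue sum of \<open>Y k\<close>.\<close>

theorem trace_powr_Jensen: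
  assumes Y: "\<And>k. k \<in> K \<Longrightarrow> diagonalizes (B k) (\<mu> k) (Y k)" and Z: "diagonalizes C \<zeta> Z"
    and K: "finite K" "K \<noteq> {}"
    and sum: "\<And>x. inner (blinfun_apply Z x) x = (\<Sum>k\<in>K. inner (blinfun_apply (Y k) x) x)"
    and q: "0 < q"
  shows trace_powr_concave: "q \<le> 1 \<Longrightarrow>
      ennreal (real (card K) powr (q - 1)) * (\<Sum>k\<in>K. eigensum q (B k) (\<mu> k)) \<le> eigensum q C \<zeta>"
    and trace_powr_convex: "1 \<le> q \<Longrightarrow>
      eigensum q C \<zeta> \<le> ennreal (real (card K) powr (q - 1)) * (\<Sum>k\<in>K. eigensum q (B k) (\<mu> k))"
proof -
  define J where "J = (\<lambda>k e. \<Sum>\<^sub>\<infinity>f\<in>B k. ennreal (\<mu> k f powr q * (cmod (cinner e f))\<^sup>2))"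
  define Q where "Q = (\<lambda>k e. inner (blinfun_apply (Y k) e) e)"
  define a where "a = real (card K) powr (q - 1)"
  have Q0: "0 \<le> Q k e" if "k \<in> K" for k e
    unfolding Q_def by (rule diagonalizes_inner_nonneg[OF Y[OF that]])
  have "(\<Sum>k\<in>K. eigensum q (B k) (\<mu> k)) = (\<Sum>k\<in>K. \<Sum>\<^sub>\<infinity>e\<in>C. J k e)"
    using infsum_infsum_cinner[OF diagonalizesD(5)[OF Y] diagonalizesD(1)[OF Z]]
    by (intro sum.cong refl) (simp add: eigensum_def J_def)
  hence sumJ: "ennreal a * (\<Sum>k\<in>K. eigensum q (B k) (\<mu> k)) = (\<Sum>\<^sub>\<infinity>e\<in>C. ennreal a * (\<Sum>k\<in>K. J k e))"
    by (simp add: infsum_sum_ennreal[OF K(1)] infsum_cmult_ennreal)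
  have zeta: "\<zeta> e = (\<Sum>k\<in>K. Q k e)" if "e \<in> C" for e
    using diagonalizes_inner_eigenvector[OF Z that] by (simp add: sum Q_def)
  have sumQ: "ennreal (a * (\<Sum>k\<in>K. Q k e powr q)) = ennreal a * (\<Sum>k\<in>K. ennreal (Q k e powr q))" for e
    by (simp add: ennreal_mult sum_nonneg sum_ennreal a_def)
  show "ennreal (real (card K) powr (q - 1)) * (\<Sum>k\<in>K. eigensum q (B k) (\<mu> k)) \<le> eigensum q C \<zeta>"
    if "q \<le> 1"
    unfolding a_def[symmetric] sumJ unfolding eigensum_def
  proof (intro infsum_mono ennreal_summable_on)
    fix e assume e: "e \<in> C"
    have "ennreal a * (\<Sum>k\<in>K. J k e) \<le> ennreal (a * (\<Sum>k\<in>K. Q k e powr q))"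
      unfolding sumQ unfolding J_def Q_def
      by (intro mult_left_mono sum_mono quadratic_form_powr_ge Y q that diagonalizesD(5)[OF Z e]) auto
    also have "\<dots> \<le> ennreal (\<zeta> e powr q)"
      unfolding zeta[OF e] a_def by (intro ennreal_leI power_mean_powr_le_one K Q0 q that)
    finally show "ennreal a * (\<Sum>k\<in>K. J k e) \<le> ennreal (\<zeta> e powr q)" .
  qed
  show "eigensum q C \<zeta> \<le> ennreal (real (card K) powr (q - 1)) * (\<Sum>k\<in>K. eigensum q (B k) (\<mu> k))"
    if "1 \<le> q"
    unfolding a_def[symmetric] sumJ unfolding eigensum_def
  proof (intro infsum_mono ennreal_summable_on)
    fix e assume e: "e \<in> C"
    have "ennreal (\<zeta> e powr q) \<le> ennreal (a * (\<Sum>k\<in>K. Q k e powr q))"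
      unfolding zeta[OF e] a_def by (intro ennreal_leI power_mean_powr_ge_one K Q0 q that)
    also have "\<dots> \<le> ennreal a * (\<Sum>k\<in>K. J k e)"
      unfolding sumQ unfolding J_def Q_def
      by (intro mult_left_mono sum_mono quadratic_form_powr_le Y that diagonalizesD(5)[OF Z e]) auto
    finally show "ennreal (\<zeta> e powr q) \<le> ennreal a * (\<Sum>k\<in>K. J k e)" .
  qed
qed

section \<open>Sums and differences of operators with total sum zero\<close>

lemma eigensum_scale:
  assumes "0 \<le> c" "\<And>f. f \<in> B \<Longrightarrow> 0 \<le> \<mu> f"
  shows "eigensum q B (\<lambda>f. c * \<mu> f) = ennreal (c powr q) * eigensum q B \<mu>"
  unfolding eigensum_def infsum_cmult_ennreal[symmetric]
  by (intro infsum_cong) (simp add: assms powr_mult ennreal_mult)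

lemma diagonalizes_scaleR:
  "diagonalizes B \<mu> T \<Longrightarrow> 0 \<le> c \<Longrightarrow> diagonalizes B (\<lambda>f. c * \<mu> f) (c *\<^sub>R T)"
  by (simp add: diagonalizes_def bounded_operators_scaleR blinfun.scaleR_left)

text \<open>The condition on \<open>\<sigma>\<close> covers both signs at once. The cross terms
  collect into inner products with the sum of all \<open>v j\<close>, which is 0.\<close>

lemma sum_norm_power2_add:
  fixes v :: "'k \<Rightarrow> 'a::real_inner" and \<sigma> :: real
  assumes "\<sigma>\<^sup>2 = 1" "(\<Sum>i\<in>I. v i) = 0"
  shows "(\<Sum>i\<in>I. \<Sum>j\<in>I. (norm (v i + \<sigma> *\<^sub>R v j))\<^sup>2) = 2 * real (card I) * (\<Sum>i\<in>I. (norm (v i))\<^sup>2)"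
proof -
  have "(norm (v i + \<sigma> *\<^sub>R v j))\<^sup>2 = (norm (v i))\<^sup>2 + (norm (v j))\<^sup>2 + 2 * \<sigma> * inner (v i) (v j)" for i j
  proof -
    have "\<sigma> = 1 \<or> \<sigma> = - 1" using assms(1) by (simp add: power2_eq_1_iff)
    thus ?thesis
      by (auto simp: power2_norm_eq_inner inner_add_left inner_add_right inner_diff_left
        inner_diff_right inner_commute algebra_simps)
  qed
  hence "(\<Sum>i\<in>I. \<Sum>j\<in>I. (norm (v i + \<sigma> *\<^sub>R v j))\<^sup>2)
      = (\<Sum>i\<in>I. real (card I) * (norm (v i))\<^sup>2 + (\<Sum>j\<in>I. (norm (v j))\<^sup>2) + 2 * \<sigma> * inner (v i) (\<Sum>j\<in>I. v j))"
    by (simp add: sum.distrib inner_sum_right sum_distrib_left)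
  also have "\<dots> = 2 * real (card I) * (\<Sum>i\<in>I. (norm (v i))\<^sup>2)"
    by (simp add: assms(2) sum.distrib sum_distrib_left mult.assoc)
  finally show ?thesis .
qed

text \<open>One operator is decomposed in two ways: into the \<open>n\<close> operators
  \<open>Y i\<close>, where Jensen's inequality applies, and into the operators
  \<open>adj (D k) o\<^sub>L D k\<close> over all index pairs, where McCarthy's applies.\<close>

lemma schatten_norm_sum_add:
  fixes A :: "nat \<Rightarrow> ('a::complex_hilbert_space \<Rightarrow>\<^sub>L 'a)" and p \<sigma> :: real
  assumes n: "n \<ge> 1" and p: "p > 0" and A: "\<And>i. i \<in> {1..n} \<Longrightarrow> compact_operator (A i)"
    and sum0: "(\<Sum>i=1..n. A i) = 0" and \<sigma>: "\<sigma>\<^sup>2 = 1"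
  shows schatten_norm_sum_add_ge: "p \<le> 2 \<Longrightarrow>
      ennreal (2 powr (p / 2) * real n powr (p - 1)) * (\<Sum>i=1..n. ennreal_powr (schatten_norm p (A i)) p)
        \<le> (\<Sum>i=1..n. \<Sum>j=1..n. ennreal_powr (schatten_norm p (A i + \<sigma> *\<^sub>R A j)) p)"
    and schatten_norm_sum_add_le: "2 \<le> p \<Longrightarrow>
      (\<Sum>i=1..n. \<Sum>j=1..n. ennreal_powr (schatten_norm p (A i + \<sigma> *\<^sub>R A j)) p)
        \<le> ennreal (2 powr (p / 2) * real n powr (p - 1)) * (\<Sum>i=1..n. ennreal_powr (schatten_norm p (A i)) p)"
proof -
  define q where "q = p / 2"
  \<comment> \<open>The factor from \<open>sum_norm_power2_add\<close>; absorbing it into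
    \<open>Y i\<close> makes both decompositions have the same sum.\<close>
  define c where "c = 2 * real n"
  define D where "D = (\<lambda>(i, j). A i + \<sigma> *\<^sub>R A j)"
  define I where "I = {1..n}"
  have q: "0 < q" using p by (simp add: q_def)
  have I: "finite I" "I \<noteq> {}" "card I = n" using n by (auto simp: I_def)
  have c: "0 < c" using n by (simp add: c_def)
  have A: "compact_operator (A i)" if "i \<in> I" for i using A that by (simp add: I_def)
  have D: "compact_operator (D k)" if "k \<in> I \<times> I" for k
    using that A by (auto simp: D_def intro!: compact_operator_add compact_operator_scaleR)
  obtain B \<mu> where B: "\<And>i. i \<in> I \<Longrightarrow> diagonalizes (B i) (\<mu> i) (adj (A i) o\<^sub>L A i)"
    using compact_operator_diagonalizes_adj_compose[OF A] by metis
  obtain B' \<mu>' where B': "\<And>k. k \<in> I \<times> I \<Longrightarrow> diagonalizes (B' k) (\<mu>' k) (adj (D k) o\<^sub>L D k)"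
    using compact_operator_diagonalizes_adj_compose[OF D] by metis
  define Y where "Y = (\<lambda>i. c *\<^sub>R (adj (A i) o\<^sub>L A i))"
  have Y: "diagonalizes (B i) (\<lambda>f. c * \<mu> i f) (Y i)" if "i \<in> I" for i
    unfolding Y_def using B[OF that] c by (simp add: diagonalizes_scaleR)
  have "compact_operator (\<Sum>i\<in>I. Y i)"
    unfolding Y_def
    by (intro compact_operator_sum compact_operator_scaleR compact_operator_compose_left
      adj_bounded_operators compact_operatorD(1) A)
  moreover have "positive_operator (\<Sum>i\<in>I. Y i)"
    unfolding Y_def using c
    by (intro positive_operator_sum positive_operator_scaleR positive_operator_adj_compose
      compact_operatorD(1) A) auto
  ultimately obtain C \<zeta> where Z: "diagonalizes C \<zeta> (\<Sum>i\<in>I. Y i)"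
    by (rule spectral_theorem_compact_positive)
  have form_Y: "inner (blinfun_apply (\<Sum>i\<in>I. Y i) x) x = (\<Sum>i\<in>I. inner (blinfun_apply (Y i) x) x)" for x
    by (simp add: blinfun.sum_left inner_sum_left)
  \<comment> \<open>The vector identity is applied to the vectors \<open>A i x\<close>; it supplies
    the equality of quadratic forms that McCarthy's inequalities require.\<close>
  have form_D: "inner (blinfun_apply (\<Sum>i\<in>I. Y i) x) x
      = (\<Sum>k\<in>I \<times> I. inner (blinfun_apply (adj (D k) o\<^sub>L D k) x) x)" for x
  proof -
    have "(\<Sum>i\<in>I. blinfun_apply (A i) x) = 0"
      using sum0 by (simp add: I_def blinfun.sum_left[symmetric])
    from sum_norm_power2_add[OF \<sigma> this]
    have "(\<Sum>k\<in>I \<times> I. (norm (blinfun_apply (D k) x))\<^sup>2) = c * (\<Sum>i\<in>I. (norm (blinfun_apply (A i) x))\<^sup>2)"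
      by (simp add: sum.cartesian_product D_def c_def I blinfun.add_left blinfun.scaleR_left
        case_prod_beta)
    moreover have "inner (blinfun_apply (Y i) x) x = c * (norm (blinfun_apply (A i) x))\<^sup>2" if "i \<in> I" for i
      using inner_adj_compose[OF compact_operatorD(1)[OF A[OF that]], of x]
      by (simp add: Y_def blinfun.scaleR_left)
    ultimately show ?thesis
      unfolding form_Y
      by (simp add: inner_adj_compose[OF compact_operatorD(1)[OF D]] sum_distrib_left
        del: blinfun_apply_blinfun_compose)
  qed
  have "(\<Sum>i\<in>I. \<Sum>j\<in>I. ennreal_powr (schatten_norm p (A i + \<sigma> *\<^sub>R A j)) p)
      = (\<Sum>k\<in>I \<times> I. ennreal_powr (schatten_norm p (D k)) p)"
    by (simp add: sum.cartesian_product D_def case_prod_beta)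
  also have "\<dots> = (\<Sum>k\<in>I \<times> I. eigensum q (B' k) (\<mu>' k))"
    by (intro sum.cong refl) (simp add: eigensum_def q_def schatten_norm_powr[OF B' p])
  finally have lhs: "(\<Sum>i\<in>I. \<Sum>j\<in>I. ennreal_powr (schatten_norm p (A i + \<sigma> *\<^sub>R A j)) p)
      = (\<Sum>k\<in>I \<times> I. eigensum q (B' k) (\<mu>' k))" .
  have "eigensum q (B i) (\<lambda>f. c * \<mu> i f) = ennreal (c powr q) * ennreal_powr (schatten_norm p (A i)) p"
    if "i \<in> I" for i
    using c diagonalizesD(3)[OF B[OF that]]
    by (simp add: eigensum_scale schatten_norm_powr[OF B[OF that] p] eigensum_def[symmetric] q_def)
  \<comment> \<open>The constant splits into \<open>n powr (q - 1)\<close> from Jensen and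
    \<open>(2 * n) powr q\<close> from scaling; the exponents of \<open>n\<close> add up to
    \<open>2 * q - 1 = p - 1\<close>.\<close>
  moreover have "2 powr (p / 2) * real n powr (p - 1) = real (card I) powr (q - 1) * c powr q"
    using n by (simp add: c_def q_def I powr_mult powr_add[symmetric])
  ultimately have rhs: "ennreal (2 powr (p / 2) * real n powr (p - 1))
        * (\<Sum>i\<in>I. ennreal_powr (schatten_norm p (A i)) p)
      = ennreal (real (card I) powr (q - 1)) * (\<Sum>i\<in>I. eigensum q (B i) (\<lambda>f. c * \<mu> i f))"
    by (simp add: ennreal_mult sum_distrib_left mult.assoc)
  have fin: "finite (I \<times> I)" using I by simp
  show "ennreal (2 powr (p / 2) * real n powr (p - 1)) * (\<Sum>i=1..n. ennreal_powr (schatten_norm p (A i)) p)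
      \<le> (\<Sum>i=1..n. \<Sum>j=1..n. ennreal_powr (schatten_norm p (A i + \<sigma> *\<^sub>R A j)) p)" if "p \<le> 2"
    unfolding I_def[symmetric] lhs rhs
    using trace_powr_concave[OF Y Z I(1,2) form_Y q] McCarthy_subadditive[OF B' Z fin form_D q] that
    by (auto simp: q_def intro: order_trans)
  show "(\<Sum>i=1..n. \<Sum>j=1..n. ennreal_powr (schatten_norm p (A i + \<sigma> *\<^sub>R A j)) p)
      \<le> ennreal (2 powr (p / 2) * real n powr (p - 1)) * (\<Sum>i=1..n. ennreal_powr (schatten_norm p (A i)) p)"
    if "2 \<le> p"
    unfolding I_def[symmetric] lhs rhs
    using trace_powr_convex[OF Y Z I(1,2) form_Y q] McCarthy_superadditive[OF B' Z fin form_D q] that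
    by (auto simp: q_def intro: order_trans)
qed

lemma ennreal_powr_two: "ennreal_powr x 2 = x\<^sup>2"
  by (cases x) (simp_all add: ennreal_powr_def power2_eq_square ennreal_mult ennreal_top_mult)

theorem corollary2p3:
  fixes A :: "nat \<Rightarrow> ('a::complex_hilbert_space \<Rightarrow>\<^sub>L 'a)" and n :: nat and p :: real
  assumes "separable_space (euclidean :: 'a topology)"
    and "n \<ge> 1" and "p > 0"
    and "\<And>i. i \<in> {1..n} \<Longrightarrow> A i \<in> schatten_class p"
    and "(\<Sum>i=1..n. A i) = 0"
  shows "(p \<le> 2 \<longrightarrow>
        ennreal (2 powr (p / 2) * real n powr (p - 1)) * (\<Sum>i=1..n. ennreal_powr (schatten_norm p (A i)) p)
          \<le> (\<Sum>i=1..n. \<Sum>j=1..n. ennreal_powr (schatten_norm p (A i + A j)) p) \<and>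
        ennreal (2 powr (p / 2) * real n powr (p - 1)) * (\<Sum>i=1..n. ennreal_powr (schatten_norm p (A i)) p)
          \<le> (\<Sum>i=1..n. \<Sum>j=1..n. ennreal_powr (schatten_norm p (A i - A j)) p))
    \<and> (2 \<le> p \<longrightarrow>
        (\<Sum>i=1..n. \<Sum>j=1..n. ennreal_powr (schatten_norm p (A i + A j)) p)
          \<le> ennreal (2 powr (p / 2) * real n powr (p - 1)) * (\<Sum>i=1..n. ennreal_powr (schatten_norm p (A i)) p) \<and>
        (\<Sum>i=1..n. \<Sum>j=1..n. ennreal_powr (schatten_norm p (A i - A j)) p)
          \<le> ennreal (2 powr (p / 2) * real n powr (p - 1)) * (\<Sum>i=1..n. ennreal_powr (schatten_norm p (A i)) p))
    \<and> (p = 2 \<longrightarrow>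
        (\<Sum>i=1..n. \<Sum>j=1..n. (schatten_norm 2 (A i - A j))\<^sup>2)
          = 2 * of_nat n * (\<Sum>i=1..n. (schatten_norm 2 (A i))\<^sup>2))"
proof -
  have A: "compact_operator (A i)" if "i \<in> {1..n}" for i
    using assms(4)[OF that] by (simp add: schatten_class_def)
  note ge = schatten_norm_sum_add_ge[OF assms(2,3) A assms(5)]
  note le = schatten_norm_sum_add_le[OF assms(2,3) A assms(5)]
  have minus: "A i + (- 1) *\<^sub>R A j = A i - A j" and plus: "A i + 1 *\<^sub>R A j = A i + A j" for i j
    by simp_all
  note ge' = ge[of "- 1", unfolded minus] and le' = le[of "- 1", unfolded minus]
  have "(\<Sum>i=1..n. \<Sum>j=1..n. (schatten_norm 2 (A i - A j))\<^sup>2)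
      = 2 * of_nat n * (\<Sum>i=1..n. (schatten_norm 2 (A i))\<^sup>2)" if p: "p = 2"
  proof -
    \<comment> \<open>At \<open>p = 2\<close> both inequalities hold with the constant
      \<open>2 * n\<close>, and antisymmetry gives equality.\<close>
    have "ennreal (2 powr (p / 2) * real n powr (p - 1)) = 2 * of_nat n"
      using assms(2) by (simp add: p ennreal_mult ennreal_of_nat_eq_real_of_nat)
    with ge' le' p show ?thesis by (intro antisym) (simp_all add: ennreal_powr_two)
  qed
  thus ?thesis using ge[of 1, unfolded plus] le[of 1, unfolded plus] ge' le' by simp
qed

end
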